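(* Let $n\geq 1$, let $p\in(0.5,1]$ and let $f:\{0,1\}^n\to\{0,1\}$ be a boolean function. Then $f$ is matchgate-computable with probability at least $p$ if and only if $f$ is WMS computable with probability at least $p$.
   Context: Matchgates. A matchgate is a two-qubit unitary $G$ whose matrix in the standard basis $|00\rangle,|01\rangle,|10\rangle,|11\rangle$ is $$G=\begin{pmatrix} a & 0 & 0 & b \\ 0 & u & v & 0 \\ 0 & x & y & 0 \\ c & 0 & 0 & d \end{pmatrix},\quad \begin{pmatrix} a & b \\ c & d \end{pmatrix}\in SU(2),\quad \begin{pmatrix} u & v \\ x & y \end{pmatrix}\in SU(2).$$ A matchgate circuit on $m$ qubits (arranged on a line $1,\dots,m$) is a unitary that is a finite product of matchgates, each acting on a pair of nearest-neighbor qubits $(k,k+1)$. Global phases are irrelevant. No bound is placed on the number of gates. Matchgate computability. Let $U$ be an $m$-qubit unitary with $m\geq n$. $U$ computes $f$ with probability at least $p$ if for every $x\in\{0,1\}^n$, preparing $U|x,0\rangle$ (where $0$ denotes a string of $m-n$ zeros) and measuring the first qubit in the computational basis yields outcome $f(x)$ with probability at least $p$. $f$ is matchgate-computable with probability at least $p$ if for some $m\geq n$ there is a matchgate circuit on $m$ qubits that computes $f$ with probability at least $p$ (no restriction on the size of $m$). Weighted majority sampling (WMS). Fix a probability distribution $\mathcal{P}=\{\pi_k\}$ on $\{1,\dots,n+1\}$ and a bit string $c=(c_1,\dots,c_{n+1})\in\{0,1\}^{n+1}$. The WMS computation associated with $\mathcal{P}$ and $c$ is: given an input $x\in\{0,1\}^n$,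 sample $k\in\{1,\dots,n+1\}$ with probability $\pi_k$; if $k\leq n$, output the bit $x_k\oplus c_k$ ($\oplus$ is addition modulo 2); if $k=n+1$, output $c_{n+1}$. The function $f$ is WMS computable with probability at least $p$ if there exist $\mathcal{P}$ and $c$ such that for every $x\in\{0,1\}^n$ the associated WMS computation on input $x$ outputs $f(x)$ with probability at least $p$. *)

theory Defs
  imports
    "HOL-Probability.Probability_Mass_Function"
    "Jordan_Normal_Form.Schur_Decomposition"
begin

unbundle no vec_syntax

definition special_unitary :: "nat \<Rightarrow> complex mat set" where
  "special_unitary k =
     {A \<in> carrier_mat k k. A * mat_adjoint A = 1\<^sub>m k \<and> mat_adjoint A * A = 1\<^sub>m k
        \<and> Determinant.det A = 1}"

definition is_matchgate :: "complex mat \<Rightarrow> bool" where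
  "is_matchgate G \<longleftrightarrow>
     (\<exists>a b c d u v x y.
        G = mat_of_rows_list 4
              [[a, 0, 0, b],
               [0, u, v, 0],
               [0, x, y, 0],
               [c, 0, 0, d]] \<and>
        mat_of_rows_list 2 [[a, b], [c, d]] \<in> special_unitary 2 \<and>
        mat_of_rows_list 2 [[u, v], [x, y]] \<in> special_unitary 2)"

definition kronecker :: "complex mat \<Rightarrow> complex mat \<Rightarrow> complex mat" where
  "kronecker A B =
     mat (dim_row A * dim_row B) (dim_col A * dim_col B)
       (\<lambda>(i, j). A $$ (i div dim_row B, j div dim_col B) * B $$ (i mod dim_row B, j mod dim_col B))"

text \<open>The gate \<open>G\<close> acting on qubits \<open>k\<close> and \<open>k + 1\<close> of a line of qubits numbered \<open>1, \<dots>, m\<close>,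
  where \<open>1 \<le> k < m\<close>.\<close>

definition on_neighbours :: "nat \<Rightarrow> nat \<Rightarrow> complex mat \<Rightarrow> complex mat" where
  "on_neighbours m k G =
     kronecker (kronecker (1\<^sub>m (2 ^ (k - 1))) G) (1\<^sub>m (2 ^ (m - k - 1)))"

text \<open>Members are automatically unitary. No closure under global phases is imposed, since a
  phase does not affect the outcome probabilities below.\<close>

inductive_set matchgate_circuits :: "nat \<Rightarrow> complex mat set" for m :: nat where
  empty: "1\<^sub>m (2 ^ m) \<in> matchgate_circuits m"
| gate: "U \<in> matchgate_circuits m \<Longrightarrow> is_matchgate G \<Longrightarrow> 1 \<le> k \<Longrightarrow> k < m \<Longrightarrow>
         on_neighbours m k G * U \<in> matchgate_circuits m"

text \<open>Bit strings are lists of booleans, with \<open>True\<close> for the bit 1, and list position \<open>i\<close> holds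
  the bit with mathematical index \<open>i + 1\<close>. The first qubit is the most significant bit of the
  position of a standard basis vector, in agreement with the order 00, 01, 10, 11 and with
  \<open>kronecker\<close>.\<close>

definition ket :: "bool list \<Rightarrow> complex vec" where
  "ket bs = unit_vec (2 ^ length bs) (horner_sum of_bool 2 (rev bs))"

definition first_qubit_prob :: "nat \<Rightarrow> complex vec \<Rightarrow> bool \<Rightarrow> real" where
  "first_qubit_prob m \<psi> b = (\<Sum>i | i < 2 ^ m \<and> bit i (m - 1) = b. (cmod (\<psi> $ i))\<^sup>2)"

definition computes ::
  "nat \<Rightarrow> nat \<Rightarrow> complex mat \<Rightarrow> (bool list \<Rightarrow> bool) \<Rightarrow> real \<Rightarrow> bool" where
  "computes n m U f p \<longleftrightarrow>
     (\<forall>x. length x = n \<longrightarrow>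
        first_qubit_prob m (U *\<^sub>v ket (x @ replicate (m - n) False)) (f x) \<ge> p)"

definition matchgate_computable :: "nat \<Rightarrow> (bool list \<Rightarrow> bool) \<Rightarrow> real \<Rightarrow> bool" where
  "matchgate_computable n f p \<longleftrightarrow>
     (\<exists>m\<ge>n. \<exists>U \<in> matchgate_circuits m. computes n m U f p)"

text \<open>Inequality of booleans is addition modulo 2.\<close>

definition wms_output :: "nat \<Rightarrow> bool list \<Rightarrow> bool list \<Rightarrow> nat \<Rightarrow> bool" where
  "wms_output n c x k = (if k \<le> n then x ! (k - 1) \<noteq> c ! (k - 1) else c ! n)"

definition wms :: "nat \<Rightarrow> nat pmf \<Rightarrow> bool list \<Rightarrow> bool list \<Rightarrow> bool pmf" where
  "wms n P c x = map_pmf (wms_output n c x) P"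

definition wms_computable :: "nat \<Rightarrow> (bool list \<Rightarrow> bool) \<Rightarrow> real \<Rightarrow> bool" where
  "wms_computable n f p \<longleftrightarrow>
     (\<exists>P c. set_pmf P \<subseteq> {1..n + 1} \<and> length c = n + 1 \<and>
        (\<forall>x. length x = n \<longrightarrow> pmf (wms n P c x) (f x) \<ge> p))"

end

(*
  In the Jordan-Wigner picture the span of the Majorana operators is invariant under conjugation by
  matchgates. The projector onto outcome 1 of the first qubit is a product of two elements of the
  span, hence so is its conjugate by a circuit, and the diagonal of such a product is a sum of
  functions of single bits. So the expectation of the outcome, as a sign, is an affine function of
  the input signs; its absolute value is at most 1 at every sign vector, so the absolute values of
  its coefficients sum to at most 1. Rescaling the sum to 1 gives WMS; as p > 1/2, the expectation
  has the sign of f and does not vanish, so rescaling only helps.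

  Conversely, a gate on a new bit and the first qubit of a circuit with outcome expectation E
  produces the expectation w x + s E, x the sign of the bit, for any |w| + |s| <= 1. Iterating this,
  starting from an ancilla, realises every WMS.
*)
theory Submission
  imports Defs
begin

section \<open>Kronecker products and adjoints\<close>

notation kronecker (infixl "\<otimes>\<^sub>k" 72)

lemma sum_lessThan_mult:
  fixes f :: "nat \<Rightarrow> 'a :: comm_monoid_add"
  shows "(\<Sum>i<a * b. f i) = (\<Sum>i<a. \<Sum>j<b. f (i * b + j))"
proof -
  have "(\<Sum>j<b. f (i * b + j)) = sum f {i * b..<i * b + b}" for i
    using sum.shift_bounds_nat_ivl[of f 0 "i * b" b] by (simp add: add.commute lessThan_atLeast0)
  then show ?thesis
    by (simp add: sum.nat_group)
qed

lemma kronecker_dims [simp]: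
  "dim_row (A \<otimes>\<^sub>k B) = dim_row A * dim_row B"
  "dim_col (A \<otimes>\<^sub>k B) = dim_col A * dim_col B"
  by (auto simp: kronecker_def)

lemma kronecker_carrier [simp, intro]:
  "A \<in> carrier_mat r c \<Longrightarrow> B \<in> carrier_mat r' c' \<Longrightarrow> A \<otimes>\<^sub>k B \<in> carrier_mat (r * r') (c * c')"
  by (intro carrier_matI) auto

lemma kronecker_index [simp]:
  "i < dim_row A * dim_row B \<Longrightarrow> j < dim_col A * dim_col B \<Longrightarrow>
    (A \<otimes>\<^sub>k B) $$ (i, j) = A $$ (i div dim_row B, j div dim_col B) * B $$ (i mod dim_row B, j mod dim_col B)"
  by (simp add: kronecker_def)

lemma div_mod_less_mult:
  fixes i :: nat
  assumes "i < a * b"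
  shows "i div b < a" "i mod b < b"
proof -
  show "i div b < a"
    using assms by (simp add: less_mult_imp_div_less)
  have "b \<noteq> 0"
    using assms by (cases b) auto
  then show "i mod b < b" by simp
qed

lemma kronecker_mult:
  assumes "A \<in> carrier_mat r s" "B \<in> carrier_mat r' s'" "C \<in> carrier_mat s t" "D \<in> carrier_mat s' t'"
  shows "(A \<otimes>\<^sub>k B) * (C \<otimes>\<^sub>k D) = (A * C) \<otimes>\<^sub>k (B * D)"
proof (rule eq_matI)
  fix i j
  assume "i < dim_row ((A * C) \<otimes>\<^sub>k (B * D))" "j < dim_col ((A * C) \<otimes>\<^sub>k (B * D))"
  then have i: "i < r * r'" and j: "j < t * t'"
    using assms by auto
  note bounds = div_mod_less_mult[OF i] div_mod_less_mult[OF j]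
  have "((A \<otimes>\<^sub>k B) * (C \<otimes>\<^sub>k D)) $$ (i, j)
      = (\<Sum>k<s * s'. (A \<otimes>\<^sub>k B) $$ (i, k) * (C \<otimes>\<^sub>k D) $$ (k, j))"
    using assms i j by (auto simp: scalar_prod_def lessThan_atLeast0)
  also have "\<dots> = (\<Sum>k<s * s'. A $$ (i div r', k div s') * B $$ (i mod r', k mod s')
                 * (C $$ (k div s', j div t') * D $$ (k mod s', j mod t')))"
    using assms i j by (intro sum.cong) auto
  \<comment> \<open>The middle index is split into quotient and remainder by \<open>s'\<close>,
    after which the double sum factors.\<close>
  also have "\<dots> = (\<Sum>k<s. \<Sum>l<s'. A $$ (i div r', k) * B $$ (i mod r', l)
                 * (C $$ (k, j div t') * D $$ (l, j mod t')))"
    unfolding sum_lessThan_mult by (intro sum.cong) auto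
  also have "\<dots> = (\<Sum>k<s. A $$ (i div r', k) * C $$ (k, j div t'))
                 * (\<Sum>l<s'. B $$ (i mod r', l) * D $$ (l, j mod t'))"
    by (simp add: sum_product mult_ac)
  also have "\<dots> = ((A * C) \<otimes>\<^sub>k (B * D)) $$ (i, j)"
    using assms i j bounds by (auto simp: scalar_prod_def lessThan_atLeast0)
  finally show "((A \<otimes>\<^sub>k B) * (C \<otimes>\<^sub>k D)) $$ (i, j) = ((A * C) \<otimes>\<^sub>k (B * D)) $$ (i, j)" .
qed (use assms in auto)

lemma kronecker_add_left:
  assumes "A \<in> carrier_mat r c" "B \<in> carrier_mat r c"
  shows "(A + B) \<otimes>\<^sub>k C = A \<otimes>\<^sub>k C + B \<otimes>\<^sub>k C"
  using assms by (intro eq_matI) (auto simp: div_mod_less_mult algebra_simps)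

lemma kronecker_add_right:
  assumes "B \<in> carrier_mat r c" "C \<in> carrier_mat r c"
  shows "A \<otimes>\<^sub>k (B + C) = A \<otimes>\<^sub>k B + A \<otimes>\<^sub>k C"
  using assms by (intro eq_matI) (auto simp: div_mod_less_mult algebra_simps)

lemma kronecker_zero_left [simp]: "0\<^sub>m r c \<otimes>\<^sub>k A = 0\<^sub>m (r * dim_row A) (c * dim_col A)"
  by (intro eq_matI) (auto simp: div_mod_less_mult)

lemma kronecker_zero_right [simp]: "A \<otimes>\<^sub>k 0\<^sub>m r c = 0\<^sub>m (dim_row A * r) (dim_col A * c)"
  by (intro eq_matI) (auto simp: div_mod_less_mult)

lemma kronecker_one_one: "1\<^sub>m a \<otimes>\<^sub>k 1\<^sub>m b = 1\<^sub>m (a * b)"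
proof (intro eq_matI)
  fix i j
  assume "i < dim_row (1\<^sub>m (a * b) :: complex mat)" "j < dim_col (1\<^sub>m (a * b) :: complex mat)"
  then have ij: "i < a * b" "j < a * b"
    by auto
  have "i div b = j div b \<and> i mod b = j mod b \<longleftrightarrow> i = j"
    by (metis div_mult_mod_eq)
  then show "(1\<^sub>m a \<otimes>\<^sub>k 1\<^sub>m b) $$ (i, j) = 1\<^sub>m (a * b) $$ (i, j)"
    using ij div_mod_less_mult[OF ij(1)] div_mod_less_mult[OF ij(2)] by auto
qed auto

lemma kronecker_assoc: "(A \<otimes>\<^sub>k B) \<otimes>\<^sub>k C = A \<otimes>\<^sub>k (B \<otimes>\<^sub>k C)"
proof (intro eq_matI)
  fix i j
  assume "i < dim_row (A \<otimes>\<^sub>k (B \<otimes>\<^sub>k C))" "j < dim_col (A \<otimes>\<^sub>k (B \<otimes>\<^sub>k C))"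
  then have i: "i < dim_row A * (dim_row B * dim_row C)" and j: "j < dim_col A * (dim_col B * dim_col C)"
    by auto
  have i': "i < dim_row A * dim_row B * dim_row C" and j': "j < dim_col A * dim_col B * dim_col C"
    using i j by (auto simp: mult.assoc)
  \<comment> \<open>Both bracketings read the same three mixed-radix digits of an index; these
    identities relate the two ways of extracting them.\<close>
  have splits: "k mod (b * c) div c = k div c mod b" "k mod (b * c) mod c = k mod c"
       "k div (b * c) = k div c div b" for k b c :: nat
    by (cases "c = 0"; simp add: div_mult2_eq mod_mult2_eq mult.commute[of b c])+
  show "((A \<otimes>\<^sub>k B) \<otimes>\<^sub>k C) $$ (i, j) = (A \<otimes>\<^sub>k (B \<otimes>\<^sub>k C)) $$ (i, j)"
    using i j i' j' div_mod_less_mult[OF i] div_mod_less_mult[OF j] div_mod_less_mult[OF i'] div_mod_less_mult[OF j']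
    by (simp only: kronecker_index kronecker_dims splits mult.assoc)
qed (auto simp: mult.assoc)

lemma kronecker_unit_right [simp]: "A \<otimes>\<^sub>k 1\<^sub>m (Suc 0) = A"
  by (intro eq_matI) auto

lemma kronecker_unit_left [simp]: "1\<^sub>m (Suc 0) \<otimes>\<^sub>k A = A"
  by (intro eq_matI) auto

lemma mat_adjoint_dims [simp]:
  "dim_row (mat_adjoint A) = dim_col A" "dim_col (mat_adjoint A) = dim_row A"
  by (auto simp: mat_adjoint_def)

lemma mat_adjoint_carrier [simp, intro]:
  "A \<in> carrier_mat r c \<Longrightarrow> mat_adjoint A \<in> carrier_mat c r"
  by (intro carrier_matI) auto

lemma mat_adjoint_index [simp]:
  "i < dim_col A \<Longrightarrow> j < dim_row A \<Longrightarrow> mat_adjoint A $$ (i, j) = cnj (A $$ (j, i))"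
  by (simp add: mat_adjoint_def mat_of_rows_def)

lemma mat_adjoint_mult:
  fixes A B :: "complex mat"
  assumes "A \<in> carrier_mat r s" "B \<in> carrier_mat s t"
  shows "mat_adjoint (A * B) = mat_adjoint B * mat_adjoint A"
  using assms by (intro eq_matI) (auto simp: scalar_prod_def mult.commute)

lemma mat_adjoint_one [simp]: "mat_adjoint (1\<^sub>m n :: complex mat) = 1\<^sub>m n"
  by (intro eq_matI) auto

lemma mat_adjoint_kronecker: "mat_adjoint (A \<otimes>\<^sub>k B) = mat_adjoint A \<otimes>\<^sub>k mat_adjoint B"
  by (intro eq_matI) (auto simp: div_mod_less_mult)

lemma det_two_by_two:
  fixes a b c d :: complex
  shows "Determinant.det (mat_of_rows_list 2 [[a, b], [c, d]]) = a * d - b * c"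
proof -
  let ?A = "mat_of_rows_list 2 [[a, b], [c, d]]"
  have "mat_delete ?A 0 0 = mat 1 1 (\<lambda>_. d)" "mat_delete ?A 1 0 = mat 1 1 (\<lambda>_. b)"
    by (auto simp: mat_delete_def mat_of_rows_list_def intro!: eq_matI)
  moreover have "?A \<in> carrier_mat 2 2"
    by (auto simp: mat_of_rows_list_def)
  ultimately show ?thesis
    by (subst laplace_expansion_column[of _ 2 0])
       (auto simp: cofactor_def det_single numeral_2_eq_2 mat_of_rows_list_def)
qed

section \<open>The span of the Majorana operators\<close>

abbreviation pauli_Z :: "complex mat" where
  "pauli_Z \<equiv> mat_of_rows_list 2 [[1, 0], [0, -1]]"

text \<open>The tensor power of Z, diagonal with sign the parity of the number of ones. It serves as
  the Jordan-Wigner string; each step appends a qubit on the right.\<close>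

fun parity :: "nat \<Rightarrow> complex mat" where
  "parity 0 = 1\<^sub>m 1"
| "parity (Suc m) = parity m \<otimes>\<^sub>k pauli_Z"

text \<open>\<open>majoranas m\<close> is the complex span of the \<open>2 m\<close> Majorana operators in Jordan-Wigner form; hollow
  matrices are the combinations of the Pauli matrices X and Y.\<close>

definition hollow :: "complex mat set" where
  "hollow = {mat_of_rows_list 2 [[0, \<alpha>], [\<beta>, 0]] | \<alpha> \<beta>. True}"

fun majoranas :: "nat \<Rightarrow> complex mat set" where
  "majoranas 0 = {0\<^sub>m 1 1}"
| "majoranas (Suc m) = {A \<otimes>\<^sub>k 1\<^sub>m 2 + parity m \<otimes>\<^sub>k B | A B. A \<in> majoranas m \<and> B \<in> hollow}"

lemma mat_of_rows_list_carrier [simp]: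
  "length rs = r \<Longrightarrow> mat_of_rows_list c rs \<in> carrier_mat r c"
  by (auto simp: mat_of_rows_list_def)

lemma mat_of_rows_list_index [simp]:
  "i < length rs \<Longrightarrow> j < c \<Longrightarrow> mat_of_rows_list c rs $$ (i, j) = rs ! i ! j"
  by (simp add: mat_of_rows_list_def)

lemma parity_carrier [simp]: "parity m \<in> carrier_mat (2 ^ m) (2 ^ m)"
proof (induction m)
  case (Suc m)
  then have "parity m \<otimes>\<^sub>k pauli_Z \<in> carrier_mat (2 ^ m * 2) (2 ^ m * 2)"
    by (intro kronecker_carrier) auto
  then show ?case
    by (simp add: mult.commute)
qed auto

lemma parity_dims [simp]: "dim_row (parity m) = 2 ^ m" "dim_col (parity m) = 2 ^ m"
  by (rule carrier_matD[OF parity_carrier])+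

lemma parity_add: "parity (r + s) = parity r \<otimes>\<^sub>k parity s"
  by (induction s) (simp_all add: kronecker_assoc)

lemma pauli_Z_square: "pauli_Z * pauli_Z = 1\<^sub>m 2"
  by (intro eq_matI) (auto simp: mat_of_rows_list_def scalar_prod_def less_Suc_eq numeral_2_eq_2)

lemma parity_square: "parity m * parity m = 1\<^sub>m (2 ^ m)"
proof (induction m)
  case (Suc m)
  have "parity (Suc m) * parity (Suc m) = (parity m * parity m) \<otimes>\<^sub>k (pauli_Z * pauli_Z)"
    unfolding parity.simps by (intro kronecker_mult[of _ "2 ^ m" "2 ^ m" _ 2 2 _ "2 ^ m" _ 2]) auto
  then show ?case
    by (simp add: Suc pauli_Z_square kronecker_one_one mult.commute)
qed auto

lemma hollow_carrier: "B \<in> hollow \<Longrightarrow> B \<in> carrier_mat 2 2"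
  by (auto simp: hollow_def)

lemma majoranas_carrier: "A \<in> majoranas m \<Longrightarrow> A \<in> carrier_mat (2 ^ m) (2 ^ m)"
proof (induction m arbitrary: A)
  case (Suc m)
  then obtain A' B where A: "A = A' \<otimes>\<^sub>k 1\<^sub>m 2 + parity m \<otimes>\<^sub>k B" "A' \<in> majoranas m" "B \<in> hollow"
    by auto
  have "A \<in> carrier_mat (2 ^ m * 2) (2 ^ m * 2)"
    unfolding A(1) by (intro add_carrier_mat kronecker_carrier parity_carrier Suc.IH A hollow_carrier) 
  then show ?case
    by (simp add: mult.commute)
qed auto

lemma majoranas_one: "majoranas (Suc 0) = hollow"
proof -
  have "0\<^sub>m (Suc 0) (Suc 0) \<otimes>\<^sub>k 1\<^sub>m 2 + 1\<^sub>m (Suc 0) \<otimes>\<^sub>k B = B" if "B \<in> hollow" for B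
    using hollow_carrier[OF that] by simp
  then show ?thesis
    by (auto; metis)
qed

text \<open>The Jordan-Wigner string of a factor on the right is the parity of everything to its left.\<close>

lemma majoranas_add:
  "majoranas (r + s) = {X \<otimes>\<^sub>k 1\<^sub>m (2 ^ s) + parity r \<otimes>\<^sub>k Y | X Y. X \<in> majoranas r \<and> Y \<in> majoranas s}"
proof (induction s)
  case 0
  have "X \<otimes>\<^sub>k 1\<^sub>m (Suc 0) + parity r \<otimes>\<^sub>k 0\<^sub>m (Suc 0) (Suc 0) = X" if "X \<in> majoranas r" for X
    using majoranas_carrier[OF that] by simp
  then show ?case
    by (auto; metis)
next
  case (Suc s)
  \<comment> \<open>Both inclusions follow from this single regrouping, read in either
    direction.\<close>
  have eq: "(X \<otimes>\<^sub>k 1\<^sub>m (2 ^ s) + parity r \<otimes>\<^sub>k Y) \<otimes>\<^sub>k 1\<^sub>m 2 + parity (r + s) \<otimes>\<^sub>k B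
      = X \<otimes>\<^sub>k 1\<^sub>m (2 ^ Suc s) + parity r \<otimes>\<^sub>k (Y \<otimes>\<^sub>k 1\<^sub>m 2 + parity s \<otimes>\<^sub>k B)"
    if "X \<in> majoranas r" "Y \<in> majoranas s" "B \<in> hollow" for X Y B
  proof -
    have X: "X \<in> carrier_mat (2 ^ r) (2 ^ r)" and Y: "Y \<in> carrier_mat (2 ^ s) (2 ^ s)"
      and B: "B \<in> carrier_mat 2 2"
      using that majoranas_carrier hollow_carrier by blast+
    have "(X \<otimes>\<^sub>k 1\<^sub>m (2 ^ s) + parity r \<otimes>\<^sub>k Y) \<otimes>\<^sub>k 1\<^sub>m 2 + parity (r + s) \<otimes>\<^sub>k B
      = X \<otimes>\<^sub>k (1\<^sub>m (2 ^ s) \<otimes>\<^sub>k 1\<^sub>m 2) + parity r \<otimes>\<^sub>k (Y \<otimes>\<^sub>k 1\<^sub>m 2) + parity r \<otimes>\<^sub>k (parity s \<otimes>\<^sub>k B)"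
      by (subst kronecker_add_left[OF kronecker_carrier[OF X one_carrier_mat]
            kronecker_carrier[OF parity_carrier Y]])
         (simp only: parity_add kronecker_assoc)
    also have "\<dots> = X \<otimes>\<^sub>k (1\<^sub>m (2 ^ s) \<otimes>\<^sub>k 1\<^sub>m 2)
        + (parity r \<otimes>\<^sub>k (Y \<otimes>\<^sub>k 1\<^sub>m 2) + parity r \<otimes>\<^sub>k (parity s \<otimes>\<^sub>k B))"
      using X Y B by (intro assoc_add_mat[of _ "2 ^ r * (2 ^ s * 2)" "2 ^ r * (2 ^ s * 2)"]
          kronecker_carrier) auto
    also have "\<dots> = X \<otimes>\<^sub>k (1\<^sub>m (2 ^ s) \<otimes>\<^sub>k 1\<^sub>m 2)
        + parity r \<otimes>\<^sub>k (Y \<otimes>\<^sub>k 1\<^sub>m 2 + parity s \<otimes>\<^sub>k B)"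
      by (subst kronecker_add_right[OF kronecker_carrier[OF Y one_carrier_mat]
            kronecker_carrier[OF parity_carrier B]]) simp
    finally show ?thesis
      by (simp add: kronecker_one_one mult.commute)
  qed
  show ?case
    unfolding add_Suc_right majoranas.simps Suc.IH
    by (safe; (rule exI conjI)+; (rule eq | rule eq[symmetric] | blast)?)
qed

section \<open>Matchgates\<close>

lemma sum_upt_four: "sum f {0..<4::nat} = f 0 + f 1 + f 2 + (f 3 :: 'a :: comm_monoid_add)"
  by (simp add: eval_nat_numeral add.assoc)

lemma sum_upt_two: "sum f {0..<2::nat} = f 0 + (f 1 :: 'a :: comm_monoid_add)"
  by (simp add: eval_nat_numeral)

lemma mat_of_rows_list_dims [simp]:
  "dim_row (mat_of_rows_list c rs) = length rs" "dim_col (mat_of_rows_list c rs) = c"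
  by (auto simp: mat_of_rows_list_def)

lemma eq_mat_four:
  assumes "A \<in> carrier_mat 4 4" "B \<in> carrier_mat 4 4"
    and "\<And>i j. i \<in> {0, 1, 2, 3} \<Longrightarrow> j \<in> {0, 1, 2, 3} \<Longrightarrow> A $$ (i, j) = B $$ (i, j)"
  shows "A = B"
proof (rule eq_matI)
  fix i j
  assume "i < dim_row B" "j < dim_col B"
  then have "i \<in> {0, 1, 2, 3}" "j \<in> {0, 1, 2, 3}"
    using assms(2) by auto
  then show "A $$ (i, j) = B $$ (i, j)"
    by (rule assms(3))
qed (use assms in auto)

lemma eq_one_mat_two_iff:
  assumes "A \<in> carrier_mat 2 2"
  shows "A = 1\<^sub>m 2 \<longleftrightarrow> A $$ (0, 0) = 1 \<and> A $$ (0, 1) = 0 \<and> A $$ (1, 0) = 0 \<and> A $$ (1, 1) = 1"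
  using assms by (auto intro!: eq_matI simp: less_2_cases_iff)

lemma special_unitary_two_iff:
  "mat_of_rows_list 2 [[a, b], [c, d]] \<in> special_unitary 2 \<longleftrightarrow>
     a * cnj a + b * cnj b = 1 \<and> a * cnj c + b * cnj d = 0 \<and>
     c * cnj a + d * cnj b = 0 \<and> c * cnj c + d * cnj d = 1 \<and>
     cnj a * a + cnj c * c = 1 \<and> cnj a * b + cnj c * d = 0 \<and>
     cnj b * a + cnj d * c = 0 \<and> cnj b * b + cnj d * d = 1 \<and> a * d - b * c = 1"
proof -
  let ?A = "mat_of_rows_list 2 [[a, b], [c, d]]"
  have "?A \<in> carrier_mat 2 2"
    by simp
  then have "?A * mat_adjoint ?A \<in> carrier_mat 2 2" "mat_adjoint ?A * ?A \<in> carrier_mat 2 2"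
    by (intro mult_carrier_mat mat_adjoint_carrier; assumption)+
  then show ?thesis
    unfolding special_unitary_def
    by (simp add: eq_one_mat_two_iff det_two_by_two scalar_prod_def sum_upt_two)
qed

text \<open>The first qubit contributes \<open>\<alpha>\<close>, \<open>\<beta>\<close> and the
  second \<open>\<gamma>\<close>, \<open>\<delta>\<close>; the minus signs are those of the string Z
  on the first qubit.\<close>

lemma majoranas_two:
  "majoranas 2 = {mat_of_rows_list 4 [[0, \<gamma>, \<alpha>, 0], [\<delta>, 0, 0, \<alpha>], [\<beta>, 0, 0, -\<gamma>], [0, \<beta>, -\<delta>, 0]]
                    | \<alpha> \<beta> \<gamma> \<delta>. True}"
proof -
  have eq: "mat_of_rows_list 2 [[0, \<alpha>], [\<beta>, 0]] \<otimes>\<^sub>k 1\<^sub>m 2 + parity (Suc 0) \<otimes>\<^sub>k mat_of_rows_list 2 [[0, \<gamma>], [\<delta>, 0]]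
     = mat_of_rows_list 4 [[0, \<gamma>, \<alpha>, 0], [\<delta>, 0, 0, \<alpha>], [\<beta>, 0, 0, -\<gamma>], [0, \<beta>, -\<delta>, 0]]"
    for \<alpha> \<beta> \<gamma> \<delta> :: complex
    by (rule eq_mat_four) (auto intro!: carrier_matI simp flip: numeral_2_eq_2)
  have "majoranas (Suc (Suc 0)) = {mat_of_rows_list 4
      [[0, \<gamma>, \<alpha>, 0], [\<delta>, 0, 0, \<alpha>], [\<beta>, 0, 0, -\<gamma>], [0, \<beta>, -\<delta>, 0]] | \<alpha> \<beta> \<gamma> \<delta>. True}"
    unfolding majoranas.simps(2)[of "Suc 0"] majoranas_one hollow_def eq[symmetric] by blast
  then show ?thesis
    by (simp only: numeral_2_eq_2)
qed

text \<open>On two qubits an element of the span is determined by its block \<open>M\<close> from odd to even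
  parity, the opposite block being minus the adjugate of \<open>M\<close>. As both blocks \<open>E\<close>, \<open>O\<close> of a
  matchgate have determinant 1, the two blocks are transformed compatibly, into \<open>adj E M O\<close> and
  its negated adjugate.\<close>

lemma matchgate_majoranas_two:
  assumes "is_matchgate G" "B \<in> majoranas 2"
  obtains B' where "B' \<in> majoranas 2" "B * G = G * B'"
proof -
  obtain a b c d u v x y where G: "G = mat_of_rows_list 4
              [[a, 0, 0, b],
               [0, u, v, 0],
               [0, x, y, 0],
               [c, 0, 0, d]]" and
    det: "a * d - b * c = 1" "u * y - v * x = 1"
    using assms(1) unfolding is_matchgate_def special_unitary_two_iff by blast
  obtain \<alpha> \<beta> \<gamma> \<delta> where B: "B = mat_of_rows_list 4
    [[0, \<gamma>, \<alpha>, 0], [\<delta>, 0, 0, \<alpha>], [\<beta>, 0, 0, -\<gamma>], [0, \<beta>, -\<delta>, 0]]"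
    using assms(2) unfolding majoranas_two by blast
  \<comment> \<open>The primed values are the entries of adj E M O, where M has the rows
    (\<open>\<gamma>\<close>, \<open>\<alpha>\<close>) and (\<open>\<beta>\<close>,
    \<open>-\<delta>\<close>).\<close>
  define \<gamma>' where "\<gamma>' = d * (\<gamma> * u + \<alpha> * x) - b * (\<beta> * u - \<delta> * x)"
  define \<alpha>' where "\<alpha>' = d * (\<gamma> * v + \<alpha> * y) - b * (\<beta> * v - \<delta> * y)"
  define \<beta>' where "\<beta>' = a * (\<beta> * u - \<delta> * x) - c * (\<gamma> * u + \<alpha> * x)"
  define \<delta>' where "\<delta>' = c * (\<gamma> * v + \<alpha> * y) - a * (\<beta> * v - \<delta> * y)"
  define B' where "B' = mat_of_rows_list 4
    [[0, \<gamma>', \<alpha>', 0], [\<delta>', 0, 0, \<alpha>'], [\<beta>', 0, 0, -\<gamma>'], [0, \<beta>', -\<delta>', 0]]"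
  \<comment> \<open>The eight nonzero entries of \<open>B * G = G * B'\<close>, with the entry of
    \<open>B * G\<close> multiplied by a determinant: that of the even block in the first four, that
    of the odd block in the others.\<close>
  have "a * \<gamma>' + b * \<beta>' = (\<gamma> * u + \<alpha> * x) * (a * d - b * c)"
    "a * \<alpha>' - b * \<delta>' = (\<gamma> * v + \<alpha> * y) * (a * d - b * c)"
    "c * \<gamma>' + d * \<beta>' = (\<beta> * u - \<delta> * x) * (a * d - b * c)"
    "c * \<alpha>' - d * \<delta>' = (\<beta> * v - \<delta> * y) * (a * d - b * c)"
    "u * \<delta>' + v * \<beta>' = (\<delta> * a + \<alpha> * c) * (u * y - v * x)"
    "u * \<alpha>' - v * \<gamma>' = (\<delta> * b + \<alpha> * d) * (u * y - v * x)"
    "x * \<delta>' + y * \<beta>' = (\<beta> * a - \<gamma> * c) * (u * y - v * x)"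
    "x * \<alpha>' - y * \<gamma>' = (\<beta> * b - \<gamma> * d) * (u * y - v * x)"
    unfolding \<alpha>'_def \<beta>'_def \<gamma>'_def \<delta>'_def by (simp_all add: algebra_simps)
  then have "B * G = G * B'"
    unfolding G B B'_def
    by (intro eq_mat_four) (auto intro!: carrier_matI simp: scalar_prod_def sum_upt_four det)
  moreover have "B' \<in> majoranas 2"
    unfolding majoranas_two B'_def by blast
  ultimately show thesis
    by (intro that)
qed

lemma matchgate_carrier: "is_matchgate G \<Longrightarrow> G \<in> carrier_mat 4 4"
  unfolding is_matchgate_def by auto

lemma matchgate_unitary:
  assumes "is_matchgate G"
  shows "mat_adjoint G * G = 1\<^sub>m 4"
  using assms unfolding is_matchgate_def special_unitary_two_iff
  by clarify (rule eq_mat_four, auto intro!: carrier_matI simp: scalar_prod_def sum_upt_four)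

text \<open>The even and odd subspaces, which a matchgate preserves, are the eigenspaces of the
  parity. Hence strings of qubits further right pass through a gate unchanged.\<close>

lemma matchgate_parity:
  assumes "is_matchgate G"
  shows "parity 2 * G = G * parity 2"
proof -
  have P: "parity 2 = mat_of_rows_list 4 [[1, 0, 0, 0], [0, -1, 0, 0], [0, 0, -1, 0], [0, 0, 0, 1]]"
    unfolding numeral_2_eq_2 parity.simps
    by (rule eq_mat_four) (auto intro!: carrier_matI simp flip: numeral_2_eq_2)
  show ?thesis
    using assms unfolding is_matchgate_def P
    by clarify (rule eq_mat_four, auto intro!: carrier_matI simp: scalar_prod_def sum_upt_four)
qed

section \<open>Gates embedded in the line of qubits\<close>

lemma on_neighbours_carrier:
  assumes "G \<in> carrier_mat 4 4" "1 \<le> k" "k < m"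
  shows "on_neighbours m k G \<in> carrier_mat (2 ^ m) (2 ^ m)"
proof -
  \<comment> \<open>There are \<open>r\<close> qubits to the left of the gate and \<open>s\<close>
    to its right; \<open>k\<close> is counted from 1.\<close>
  obtain r s where k: "k = Suc r" and m: "m = r + 2 + s"
    using assms by (metis One_nat_def Suc_le_D add_2_eq_Suc' add_Suc_right add_Suc Suc_eq_plus1 less_imp_Suc_add)
  have "(1\<^sub>m (2 ^ r) \<otimes>\<^sub>k G) \<otimes>\<^sub>k 1\<^sub>m (2 ^ s) \<in> carrier_mat (2 ^ r * 4 * 2 ^ s) (2 ^ r * 4 * 2 ^ s)"
    using assms(1) by (intro kronecker_carrier) auto
  moreover have "(2::nat) ^ m = 2 ^ r * 4 * 2 ^ s"
    by (simp add: m power_add)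
  moreover have "on_neighbours m k G = (1\<^sub>m (2 ^ r) \<otimes>\<^sub>k G) \<otimes>\<^sub>k 1\<^sub>m (2 ^ s)"
    by (simp add: on_neighbours_def k m)
  ultimately show ?thesis
    by metis
qed

lemma on_neighbours_unitary:
  assumes "is_matchgate G" "1 \<le> k" "k < m"
  shows "mat_adjoint (on_neighbours m k G) * on_neighbours m k G = 1\<^sub>m (2 ^ m)"
proof -
  obtain r s where k: "k = Suc r" and m: "m = r + 2 + s"
    using assms by (metis One_nat_def Suc_le_D add_2_eq_Suc' add_Suc_right add_Suc Suc_eq_plus1 less_imp_Suc_add)
  note G = matchgate_carrier[OF assms(1)]
  have on: "on_neighbours m k G = (1\<^sub>m (2 ^ r) \<otimes>\<^sub>k G) \<otimes>\<^sub>k 1\<^sub>m (2 ^ s)"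
    by (simp add: on_neighbours_def k m)
  have "mat_adjoint (1\<^sub>m (2 ^ r) \<otimes>\<^sub>k G) * (1\<^sub>m (2 ^ r) \<otimes>\<^sub>k G)
      = (1\<^sub>m (2 ^ r) * 1\<^sub>m (2 ^ r)) \<otimes>\<^sub>k (mat_adjoint G * G)"
    unfolding mat_adjoint_kronecker mat_adjoint_one
    by (rule kronecker_mult one_carrier_mat mat_adjoint_carrier G)+
  then have "mat_adjoint (1\<^sub>m (2 ^ r) \<otimes>\<^sub>k G) * (1\<^sub>m (2 ^ r) \<otimes>\<^sub>k G) = 1\<^sub>m (2 ^ r * 4)"
    by (simp add: matchgate_unitary[OF assms(1)] kronecker_one_one)
  moreover have "mat_adjoint (on_neighbours m k G) * on_neighbours m k G
     = (mat_adjoint (1\<^sub>m (2 ^ r) \<otimes>\<^sub>k G) * (1\<^sub>m (2 ^ r) \<otimes>\<^sub>k G)) \<otimes>\<^sub>k (1\<^sub>m (2 ^ s) * 1\<^sub>m (2 ^ s))"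
    unfolding on mat_adjoint_kronecker[of "1\<^sub>m (2 ^ r) \<otimes>\<^sub>k G"] mat_adjoint_one
    by (rule kronecker_mult one_carrier_mat mat_adjoint_carrier kronecker_carrier G)+
  moreover have "(2::nat) ^ m = 2 ^ r * 4 * 2 ^ s"
    by (simp add: m power_add)
  ultimately show ?thesis
    by (simp add: kronecker_one_one)
qed

text \<open>Split \<open>A\<close> into parts belonging to the qubits left of, at and right of the
  gate. The left part acts on other qubits and commutes; the middle part is transformed as on two
  qubits, its string lying left of the gate; the right part meets the gate only through its string,
  which commutes with it.\<close>

lemma on_neighbours_majoranas:
  assumes "is_matchgate G" "1 \<le> k" "k < m" "A \<in> majoranas m"
  obtains A' where "A' \<in> majoranas m" "A * on_neighbours m k G = on_neighbours m k G * A'"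
proof -
  obtain r s where k: "k = Suc r" and m: "m = r + 2 + s"
    using assms by (metis One_nat_def Suc_le_D add_2_eq_Suc' add_Suc_right add_Suc Suc_eq_plus1 less_imp_Suc_add)
  define I :: "nat \<Rightarrow> complex mat" where "I = (\<lambda>q. 1\<^sub>m (2 ^ q))"
  have I: "I q \<in> carrier_mat (2 ^ q) (2 ^ q)" for q
    by (simp add: I_def)
  have I_mult: "I q * X = X" "X * I q = X" if "X \<in> carrier_mat (2 ^ q) (2 ^ q)" for X q
    using that by (simp_all add: I_def)
  have G: "G \<in> carrier_mat (2 ^ 2) (2 ^ 2)"
    using matchgate_carrier[OF assms(1)] by simp
  define H where "H = I r \<otimes>\<^sub>k G"
  have H: "H \<in> carrier_mat (2 ^ (r + 2)) (2 ^ (r + 2))"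
    unfolding H_def power_add by (intro kronecker_carrier I G)
  have H': "H \<in> carrier_mat (2 ^ r * 2 ^ 2) (2 ^ r * 2 ^ 2)"
    using H unfolding power_add .
  have on: "on_neighbours m k G = H \<otimes>\<^sub>k I s"
    by (simp add: on_neighbours_def k m H_def I_def)
  obtain X C where XC: "A = X \<otimes>\<^sub>k I s + parity (r + 2) \<otimes>\<^sub>k C" "X \<in> majoranas (r + 2)" "C \<in> majoranas s"
    using assms(4) unfolding m majoranas_add[of "r + 2" s] I_def by blast
  obtain Y B where YB: "X = Y \<otimes>\<^sub>k I 2 + parity r \<otimes>\<^sub>k B" "Y \<in> majoranas r" "B \<in> majoranas 2"
    using XC(2) unfolding majoranas_add[of r 2] I_def by blast
  obtain B' where B': "B' \<in> majoranas 2" "B * G = G * B'"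
    using matchgate_majoranas_two[OF assms(1) YB(3)] by blast
  define X' where "X' = Y \<otimes>\<^sub>k I 2 + parity r \<otimes>\<^sub>k B'"
  have X': "X' \<in> majoranas (r + 2)"
    unfolding majoranas_add[of r 2] X'_def I_def using YB B' by blast
  define A' where "A' = X' \<otimes>\<^sub>k I s + parity (r + 2) \<otimes>\<^sub>k C"
  have A': "A' \<in> majoranas m"
    unfolding m majoranas_add[of "r + 2" s] A'_def I_def using XC X' by blast
  note c = majoranas_carrier[OF XC(2)] majoranas_carrier[OF XC(3)] majoranas_carrier[OF YB(2)]
    majoranas_carrier[OF YB(3)] majoranas_carrier[OF B'(1)] majoranas_carrier[OF X'] I G H parity_carrier
  have XH: "X * H = H * X'"
  proof -
    have "X * H = (Y \<otimes>\<^sub>k I 2) * H + (parity r \<otimes>\<^sub>k B) * H"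
      unfolding YB(1)
      by (rule add_mult_distrib_mat[OF kronecker_carrier[OF c(3) I] kronecker_carrier[OF parity_carrier c(4)] H'])
    also have "(Y \<otimes>\<^sub>k I 2) * H = (Y * I r) \<otimes>\<^sub>k (I 2 * G)"
      unfolding H_def by (rule kronecker_mult c)+
    also have "\<dots> = (I r * Y) \<otimes>\<^sub>k (G * I 2)"
      using c by (simp only: I_mult)
    also have "\<dots> = H * (Y \<otimes>\<^sub>k I 2)"
      unfolding H_def by (rule kronecker_mult[symmetric] c)+
    also have "(parity r \<otimes>\<^sub>k B) * H = (parity r * I r) \<otimes>\<^sub>k (B * G)"
      unfolding H_def by (rule kronecker_mult c)+
    also have "\<dots> = (I r * parity r) \<otimes>\<^sub>k (G * B')"
      using c by (simp only: I_mult B'(2))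
    also have "\<dots> = H * (parity r \<otimes>\<^sub>k B')"
      unfolding H_def by (rule kronecker_mult[symmetric] c)+
    also have "H * (Y \<otimes>\<^sub>k I 2) + H * (parity r \<otimes>\<^sub>k B') = H * X'"
      unfolding X'_def
      by (rule mult_add_distrib_mat[symmetric, OF H' kronecker_carrier[OF c(3) I] kronecker_carrier[OF parity_carrier c(5)]])
    finally show ?thesis .
  qed
  \<comment> \<open>The string of the qubits on the right covers both qubits of the gate, so parity
    preservation is what is needed here.\<close>
  have PH: "parity (r + 2) * H = H * parity (r + 2)"
  proof -
    have "parity (r + 2) * H = (parity r * I r) \<otimes>\<^sub>k (parity 2 * G)"
      unfolding H_def parity_add by (rule kronecker_mult c)+
    also have "\<dots> = (I r * parity r) \<otimes>\<^sub>k (G * parity 2)"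
      using c by (simp only: I_mult matchgate_parity[OF assms(1)])
    also have "\<dots> = H * parity (r + 2)"
      unfolding H_def parity_add by (rule kronecker_mult[symmetric] c)+
    finally show ?thesis .
  qed
  have "A * (H \<otimes>\<^sub>k I s) = (X \<otimes>\<^sub>k I s) * (H \<otimes>\<^sub>k I s) + (parity (r + 2) \<otimes>\<^sub>k C) * (H \<otimes>\<^sub>k I s)"
    unfolding XC(1) by (rule add_mult_distrib_mat kronecker_carrier c)+
  also have "(X \<otimes>\<^sub>k I s) * (H \<otimes>\<^sub>k I s) = (X * H) \<otimes>\<^sub>k (I s * I s)"
    by (rule kronecker_mult c)+
  also have "\<dots> = (H \<otimes>\<^sub>k I s) * (X' \<otimes>\<^sub>k I s)"
    unfolding XH by (rule kronecker_mult[symmetric] c)+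
  also have "(parity (r + 2) \<otimes>\<^sub>k C) * (H \<otimes>\<^sub>k I s) = (parity (r + 2) * H) \<otimes>\<^sub>k (C * I s)"
    by (rule kronecker_mult c)+
  also have "\<dots> = (H * parity (r + 2)) \<otimes>\<^sub>k (I s * C)"
    using c by (simp only: I_mult PH)
  also have "\<dots> = (H \<otimes>\<^sub>k I s) * (parity (r + 2) \<otimes>\<^sub>k C)"
    by (rule kronecker_mult[symmetric] c)+
  also have "(H \<otimes>\<^sub>k I s) * (X' \<otimes>\<^sub>k I s) + (H \<otimes>\<^sub>k I s) * (parity (r + 2) \<otimes>\<^sub>k C) = (H \<otimes>\<^sub>k I s) * A'"
    unfolding A'_def by (rule mult_add_distrib_mat[symmetric] kronecker_carrier c)+
  finally show thesis
    using that A' unfolding on by blast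
qed

section \<open>Unitarity of circuits and invariance of the span\<close>

lemma circuit_carrier: "U \<in> matchgate_circuits m \<Longrightarrow> U \<in> carrier_mat (2 ^ m) (2 ^ m)"
  by (induction rule: matchgate_circuits.induct)
     (auto intro!: mult_carrier_mat on_neighbours_carrier matchgate_carrier)

lemma circuit_unitary:
  "U \<in> matchgate_circuits m \<Longrightarrow> mat_adjoint U * U = 1\<^sub>m (2 ^ m)"
proof (induction rule: matchgate_circuits.induct)
  case (gate U G k)
  let ?M = "on_neighbours m k G"
  have U: "U \<in> carrier_mat (2 ^ m) (2 ^ m)"
    using gate circuit_carrier by blast
  have M: "?M \<in> carrier_mat (2 ^ m) (2 ^ m)"
    using gate on_neighbours_carrier matchgate_carrier by blast
  note c = U M U[THEN mat_adjoint_carrier] M[THEN mat_adjoint_carrier]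
  have "mat_adjoint (?M * U) * (?M * U) = mat_adjoint U * (mat_adjoint ?M * (?M * U))"
    unfolding mat_adjoint_mult[OF M U] by (rule assoc_mult_mat c mult_carrier_mat)+
  also have "mat_adjoint ?M * (?M * U) = (mat_adjoint ?M * ?M) * U"
    by (rule assoc_mult_mat[symmetric] c)+
  also have "mat_adjoint U * (mat_adjoint ?M * ?M * U) = 1\<^sub>m (2 ^ m)"
    using gate U by (simp add: on_neighbours_unitary)
  finally show ?case .
qed simp

text \<open>\<open>A\<close> is moved through one gate at a time, the last gate first. Each gate
  replaces it by another element of the span, so the induction is over all \<open>A\<close>.\<close>

lemma circuit_majoranas:
  assumes "U \<in> matchgate_circuits m" "A \<in> majoranas m"
  shows "\<exists>A'\<in>majoranas m. A * U = U * A'"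
  using assms
proof (induction arbitrary: A rule: matchgate_circuits.induct)
  case empty
  then show ?case
    using majoranas_carrier[OF empty] by (intro bexI[of _ A]) auto
next
  case (gate U G k)
  let ?M = "on_neighbours m k G"
  obtain A1 where A1: "A1 \<in> majoranas m" "A * ?M = ?M * A1"
    using on_neighbours_majoranas gate.hyps gate.prems by metis
  obtain A2 where A2: "A2 \<in> majoranas m" "A1 * U = U * A2"
    using gate.IH[OF A1(1)] by blast
  have c: "U \<in> carrier_mat (2 ^ m) (2 ^ m)" "?M \<in> carrier_mat (2 ^ m) (2 ^ m)"
    "A \<in> carrier_mat (2 ^ m) (2 ^ m)" "A1 \<in> carrier_mat (2 ^ m) (2 ^ m)" "A2 \<in> carrier_mat (2 ^ m) (2 ^ m)"
    using gate A1 A2 circuit_carrier on_neighbours_carrier matchgate_carrier majoranas_carrier by blast+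
  have "A * (?M * U) = (A * ?M) * U"
    by (rule assoc_mult_mat[symmetric] c)+
  also have "\<dots> = ?M * (A1 * U)"
    unfolding A1(2) by (rule assoc_mult_mat c)+
  also have "\<dots> = (?M * U) * A2"
    unfolding A2(2) by (rule assoc_mult_mat[symmetric] c)+
  finally have "A * (?M * U) = (?M * U) * A2" .
  then show ?case
    using A2 by blast
qed

section \<open>Outcome probabilities\<close>

abbreviation ket_index :: "bool list \<Rightarrow> nat" where
  "ket_index bs \<equiv> horner_sum of_bool 2 (rev bs)"

lemma ket_index_less [simp]: "ket_index bs < 2 ^ length bs"
  using horner_sum_of_bool_2_less[of "rev bs", where 'a = nat] by simp

text \<open>The last bit is the least significant one, which matches the rightmost Kronecker factor
  that the recursion of \<open>majoranas\<close> splits off.\<close>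

lemma ket_index_snoc: "ket_index (bs @ [b]) = 2 * ket_index bs + of_bool b"
  by simp

lemma hollow_diagonal: "B \<in> hollow \<Longrightarrow> i < 2 \<Longrightarrow> B $$ (i, i) = 0"
  by (auto simp: hollow_def less_2_cases_iff)

text \<open>The cross terms do not contribute as hollow matrices have zero diagonal.\<close>

lemma majoranas_mult_diagonal:
  assumes "A \<in> majoranas m" "B \<in> majoranas m"
  obtains g :: "nat \<Rightarrow> bool \<Rightarrow> complex" where
    "\<And>bs. length bs = m \<Longrightarrow> (A * B) $$ (ket_index bs, ket_index bs) = (\<Sum>q<m. g q (bs ! q))"
  using assms
proof (induction m arbitrary: A B thesis)
  case 0
  show ?case
    by (rule 0(1)) (use 0 in auto)
next
  case (Suc m)
  obtain X V where A: "A = X \<otimes>\<^sub>k 1\<^sub>m 2 + parity m \<otimes>\<^sub>k V" "X \<in> majoranas m" "V \<in> hollow"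
    using Suc.prems(2) by auto
  obtain Y W where B: "B = Y \<otimes>\<^sub>k 1\<^sub>m 2 + parity m \<otimes>\<^sub>k W" "Y \<in> majoranas m" "W \<in> hollow"
    using Suc.prems(3) by auto
  obtain g :: "nat \<Rightarrow> bool \<Rightarrow> complex" where
    g: "(X * Y) $$ (ket_index bs, ket_index bs) = (\<Sum>q<m. g q (bs ! q))" if "length bs = m" for bs
    using Suc.IH[OF _ A(2) B(2)] by blast
  have X: "X \<in> carrier_mat (2 ^ m) (2 ^ m)" and Y: "Y \<in> carrier_mat (2 ^ m) (2 ^ m)"
    using A B majoranas_carrier by blast+
  have V: "V \<in> carrier_mat 2 2" and W: "W \<in> carrier_mat 2 2"
    using A B hollow_carrier by blast+
  note c = X Y V W parity_carrier one_carrier_mat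
  have "A * B = (X \<otimes>\<^sub>k 1\<^sub>m 2) * (Y \<otimes>\<^sub>k 1\<^sub>m 2 + parity m \<otimes>\<^sub>k W)
      + (parity m \<otimes>\<^sub>k V) * (Y \<otimes>\<^sub>k 1\<^sub>m 2 + parity m \<otimes>\<^sub>k W)"
    unfolding A(1) B(1) by (rule add_mult_distrib_mat add_carrier_mat kronecker_carrier c)+
  also have "(X \<otimes>\<^sub>k 1\<^sub>m 2) * (Y \<otimes>\<^sub>k 1\<^sub>m 2 + parity m \<otimes>\<^sub>k W)
      = (X \<otimes>\<^sub>k 1\<^sub>m 2) * (Y \<otimes>\<^sub>k 1\<^sub>m 2) + (X \<otimes>\<^sub>k 1\<^sub>m 2) * (parity m \<otimes>\<^sub>k W)"
    by (rule mult_add_distrib_mat kronecker_carrier c)+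
  also have "(parity m \<otimes>\<^sub>k V) * (Y \<otimes>\<^sub>k 1\<^sub>m 2 + parity m \<otimes>\<^sub>k W)
      = (parity m \<otimes>\<^sub>k V) * (Y \<otimes>\<^sub>k 1\<^sub>m 2) + (parity m \<otimes>\<^sub>k V) * (parity m \<otimes>\<^sub>k W)"
    by (rule mult_add_distrib_mat kronecker_carrier c)+
  also have "(X \<otimes>\<^sub>k 1\<^sub>m 2) * (Y \<otimes>\<^sub>k 1\<^sub>m 2) = (X * Y) \<otimes>\<^sub>k (1\<^sub>m 2 * 1\<^sub>m 2)"
    by (rule kronecker_mult c)+
  also have "(X \<otimes>\<^sub>k 1\<^sub>m 2) * (parity m \<otimes>\<^sub>k W) = (X * parity m) \<otimes>\<^sub>k (1\<^sub>m 2 * W)"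
    by (rule kronecker_mult c)+
  also have "(parity m \<otimes>\<^sub>k V) * (Y \<otimes>\<^sub>k 1\<^sub>m 2) = (parity m * Y) \<otimes>\<^sub>k (V * 1\<^sub>m 2)"
    by (rule kronecker_mult c)+
  also have "(parity m \<otimes>\<^sub>k V) * (parity m \<otimes>\<^sub>k W) = (parity m * parity m) \<otimes>\<^sub>k (V * W)"
    by (rule kronecker_mult c)+
  \<comment> \<open>The strings in the last of the four terms cancel, so its diagonal depends on the
    last bit alone. The two middle terms have a hollow factor.\<close>
  finally have AB: "A * B = (X * Y) \<otimes>\<^sub>k 1\<^sub>m 2 + (X * parity m) \<otimes>\<^sub>k W
      + ((parity m * Y) \<otimes>\<^sub>k V + 1\<^sub>m (2 ^ m) \<otimes>\<^sub>k (V * W))"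
    using V W by (simp add: parity_square)
  have diag: "(A * B) $$ (2 * i + j, 2 * i + j) = (X * Y) $$ (i, i) + (V * W) $$ (j, j)"
    if "i < 2 ^ m" "j < 2" for i j
  proof -
    have "2 * i + j < 2 ^ m * 2" "(2 * i + j) div 2 = i" "(2 * i + j) mod 2 = j"
      using that by auto
    then show ?thesis
      unfolding AB using that c by (simp add: hollow_diagonal A(3) B(3) del: mult_Suc_right)
  qed
  define g' where "g' q b = (if q < m then g q b else (V * W) $$ (of_bool b, of_bool b))" for q b
  show ?case
  proof (rule Suc.prems(1))
    fix bs :: "bool list"
    assume "length bs = Suc m"
    then obtain cs b where bs: "bs = cs @ [b]" "length cs = m"
      by (metis length_Suc_conv_rev)
    have "(A * B) $$ (ket_index bs, ket_index bs)
        = (X * Y) $$ (ket_index cs, ket_index cs) + (V * W) $$ (of_bool b, of_bool b)"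
      unfolding bs(1) ket_index_snoc using ket_index_less[of cs] bs(2) by (intro diag) auto
    also have "\<dots> = (\<Sum>q<m. g' q (bs ! q)) + g' m (bs ! m)"
      using bs by (auto simp: g g'_def nth_append)
    finally show "(A * B) $$ (ket_index bs, ket_index bs) = (\<Sum>q<Suc m. g' q (bs ! q))"
      by simp
  qed
qed

lemma mult_mat_vec_ket:
  assumes "U \<in> carrier_mat r (2 ^ length bs)" "i < r"
  shows "(U *\<^sub>v ket bs) $ i = U $$ (i, ket_index bs)"
proof -
  have "(U *\<^sub>v ket bs) $ i = (\<Sum>k<2 ^ length bs. U $$ (i, k) * (if k = ket_index bs then 1 else 0))"
    using assms by (auto simp: scalar_prod_def ket_def lessThan_atLeast0 intro!: sum.cong)
  also have "\<dots> = (\<Sum>k<2 ^ length bs. if k = ket_index bs then U $$ (i, k) else 0)"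
    by (intro sum.cong) auto
  finally show ?thesis
    by (simp add: sum.delta)
qed

lemma mat_adjoint_mult_index:
  assumes "A \<in> carrier_mat r c" "B \<in> carrier_mat r c'" "i < c" "j < c'"
  shows "(mat_adjoint A * B) $$ (i, j) = (\<Sum>k<r. cnj (A $$ (k, i)) * B $$ (k, j))"
  using assms by (simp add: scalar_prod_def lessThan_atLeast0)

text \<open>The squared norm of a column is a diagonal entry of the adjoint of \<open>U\<close>
  times \<open>U\<close>.\<close>

lemma circuit_column_norm:
  assumes "U \<in> matchgate_circuits m" "j < 2 ^ m"
  shows "(\<Sum>i<2 ^ m. (cmod (U $$ (i, j)))\<^sup>2) = 1"
proof -
  note U = circuit_carrier[OF assms(1)]
  have "complex_of_real (\<Sum>i<2 ^ m. (cmod (U $$ (i, j)))\<^sup>2) = (mat_adjoint U * U) $$ (j, j)"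
    using assms(2) by (simp add: mat_adjoint_mult_index[OF U U] complex_norm_square mult.commute del: of_real_power)
  also have "\<dots> = 1"
    using assms by (simp add: circuit_unitary)
  finally show ?thesis
    by (metis of_real_eq_1_iff)
qed

lemma first_qubit_prob_ket:
  assumes "U \<in> carrier_mat (2 ^ m) (2 ^ m)" "length bs = m"
  shows "first_qubit_prob m (U *\<^sub>v ket bs) b
    = (\<Sum>i<2 ^ m. if bit i (m - 1) = b then (cmod (U $$ (i, ket_index bs)))\<^sup>2 else 0)"
proof -
  have "first_qubit_prob m (U *\<^sub>v ket bs) b
    = (\<Sum>i\<in>{i \<in> {..<2 ^ m}. bit i (m - 1) = b}. (cmod (U $$ (i, ket_index bs)))\<^sup>2)"
    unfolding first_qubit_prob_def using assms by (intro sum.cong) (auto simp: mult_mat_vec_ket simp del: index_mult_mat_vec)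
  then show ?thesis
    by (simp only: sum.inter_filter finite_lessThan)
qed

lemma first_qubit_prob_False:
  assumes "U \<in> matchgate_circuits m" "length bs = m"
  shows "first_qubit_prob m (U *\<^sub>v ket bs) False = 1 - first_qubit_prob m (U *\<^sub>v ket bs) True"
proof -
  have "first_qubit_prob m (U *\<^sub>v ket bs) False + first_qubit_prob m (U *\<^sub>v ket bs) True
     = (\<Sum>i<2 ^ m. (cmod (U $$ (i, ket_index bs)))\<^sup>2)"
    unfolding first_qubit_prob_ket[OF circuit_carrier[OF assms(1)] assms(2)] sum.distrib[symmetric]
    by (intro sum.cong) auto
  also have "\<dots> = 1"
    using assms ket_index_less[of bs] by (intro circuit_column_norm) auto
  finally show ?thesis
    by simp
qed

lemma first_qubit_prob_nonneg: "0 \<le> first_qubit_prob m \<psi> b"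
  by (simp add: first_qubit_prob_def sum_nonneg)

text \<open>The probability is a diagonal entry of the conjugate by \<open>U\<close> of the
  projector onto outcome 1. The projector is a product of two elements of the span, so its conjugate
  is one too, and \<open>majoranas_mult_diagonal\<close> applies.\<close>

lemma first_qubit_prob_sum_of_bits:
  assumes U: "U \<in> matchgate_circuits m" and m: "1 \<le> m"
  obtains g :: "nat \<Rightarrow> bool \<Rightarrow> real" where
    "\<And>bs. length bs = m \<Longrightarrow> first_qubit_prob m (U *\<^sub>v ket bs) True = (\<Sum>q<m. g q (bs ! q))"
proof -
  obtain s where s: "m = Suc 0 + s"
    using m by (metis One_nat_def le_Suc_ex)
  define K :: "complex mat" where "K = 1\<^sub>m (2 ^ s)"
  \<comment> \<open>\<open>P\<close> projects a qubit onto 1; it factors into the raising operator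
    \<open>a\<close> and the lowering operator \<open>b\<close>, both hollow.\<close>
  define P where "P = mat_of_rows_list 2 [[0, 0], [0, 1 :: complex]]"
  define a where "a = mat_of_rows_list 2 [[0, 0], [1, 0 :: complex]]"
  define b where "b = mat_of_rows_list 2 [[0, 1], [0, 0 :: complex]]"
  have c: "K \<in> carrier_mat (2 ^ s) (2 ^ s)" "P \<in> carrier_mat 2 2" "a \<in> carrier_mat 2 2" "b \<in> carrier_mat 2 2"
    by (auto simp: K_def P_def a_def b_def)
  have "a * b = P"
    unfolding a_def b_def P_def
    by (intro eq_matI) (auto simp: less_2_cases_iff scalar_prod_def sum_upt_two simp flip: numeral_2_eq_2)
  moreover have "(a \<otimes>\<^sub>k K) * (b \<otimes>\<^sub>k K) = (a * b) \<otimes>\<^sub>k (K * K)"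
    by (rule kronecker_mult c)+
  moreover have "K * K = K"
    by (simp add: K_def)
  ultimately have PK: "P \<otimes>\<^sub>k K = (a \<otimes>\<^sub>k K) * (b \<otimes>\<^sub>k K)"
    by simp
  \<comment> \<open>Operators on the first qubit have no string to their left, so they lie in the
    span once the remaining qubits contribute zero.\<close>
  have left: "x \<otimes>\<^sub>k K \<in> majoranas m" if "x \<in> hollow" for x
  proof -
    have zero: "0\<^sub>m (2 ^ q) (2 ^ q) \<in> majoranas q" for q
    proof (induction q)
      case (Suc q)
      have "0\<^sub>m 2 2 = mat_of_rows_list 2 [[0, 0], [0, 0 :: complex]]"
        by (intro eq_matI) (auto simp: less_2_cases_iff simp flip: numeral_2_eq_2)
      then have "0\<^sub>m 2 2 \<in> hollow"
        by (auto simp: hollow_def)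
      moreover have "0\<^sub>m (2 ^ Suc q) (2 ^ Suc q) = 0\<^sub>m (2 ^ q) (2 ^ q) \<otimes>\<^sub>k 1\<^sub>m 2 + parity q \<otimes>\<^sub>k 0\<^sub>m 2 2"
        by (simp add: mult.commute)
      ultimately show ?case
        unfolding majoranas.simps using Suc by blast
    qed auto
    have "x \<otimes>\<^sub>k 1\<^sub>m (2 ^ s) + parity (Suc 0) \<otimes>\<^sub>k 0\<^sub>m (2 ^ s) (2 ^ s) \<in> majoranas m"
      unfolding s majoranas_add[of "Suc 0" s] majoranas_one using that zero by blast
    moreover have "x \<otimes>\<^sub>k 1\<^sub>m (2 ^ s) + parity (Suc 0) \<otimes>\<^sub>k 0\<^sub>m (2 ^ s) (2 ^ s) = x \<otimes>\<^sub>k K"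
      using hollow_carrier[OF that] unfolding K_def kronecker_zero_right
      by (intro right_add_zero_mat carrier_matI) auto
    ultimately show ?thesis
      by simp
  qed
  have "a \<in> hollow" "b \<in> hollow"
    by (auto simp: hollow_def a_def b_def)
  then obtain A B where
    A: "A \<in> majoranas m" "(a \<otimes>\<^sub>k K) * U = U * A" and B: "B \<in> majoranas m" "(b \<otimes>\<^sub>k K) * U = U * B"
    using circuit_majoranas[OF U] left by metis
  obtain g where g: "(A * B) $$ (ket_index bs, ket_index bs) = (\<Sum>q<m. g q (bs ! q))" if "length bs = m" for bs
    using majoranas_mult_diagonal[OF A(1) B(1)] by blast
  have c': "U \<in> carrier_mat (2 ^ m) (2 ^ m)" "mat_adjoint U \<in> carrier_mat (2 ^ m) (2 ^ m)"
     "A \<in> carrier_mat (2 ^ m) (2 ^ m)" "B \<in> carrier_mat (2 ^ m) (2 ^ m)"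
     "a \<otimes>\<^sub>k K \<in> carrier_mat (2 ^ m) (2 ^ m)" "b \<otimes>\<^sub>k K \<in> carrier_mat (2 ^ m) (2 ^ m)"
    using circuit_carrier[OF U] A(1) B(1) majoranas_carrier left \<open>a \<in> hollow\<close> \<open>b \<in> hollow\<close>
    by (blast intro: mat_adjoint_carrier)+
  have "(P \<otimes>\<^sub>k K) * U = (a \<otimes>\<^sub>k K) * ((b \<otimes>\<^sub>k K) * U)"
    unfolding PK by (rule assoc_mult_mat c')+
  also have "\<dots> = ((a \<otimes>\<^sub>k K) * U) * B"
    unfolding B(2) by (rule assoc_mult_mat[symmetric] c')+
  also have "\<dots> = U * (A * B)"
    unfolding A(2) by (rule assoc_mult_mat c')+
  finally have "mat_adjoint U * ((P \<otimes>\<^sub>k K) * U) = mat_adjoint U * (U * (A * B))"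
    by simp
  also have "\<dots> = (mat_adjoint U * U) * (A * B)"
    by (rule assoc_mult_mat[symmetric] mult_carrier_mat c')+
  also have "\<dots> = A * B"
    unfolding circuit_unitary[OF U] by (rule left_mult_one_mat mult_carrier_mat c')+
  finally have conj: "mat_adjoint U * ((P \<otimes>\<^sub>k K) * U) = A * B" .
  \<comment> \<open>The first qubit is the most significant bit, at position
    \<open>m - 1 = s\<close>; the projector keeps the rows in which it is set.\<close>
  have Pi: "((P \<otimes>\<^sub>k K) * U) $$ (i, j) = (if bit i (m - 1) then U $$ (i, j) else 0)"
    if "i < 2 ^ m" "j < 2 ^ m" for i j
  proof -
    have i: "i < 2 * 2 ^ s"
      using that by (simp add: s)
    have entry: "(P \<otimes>\<^sub>k K) $$ (i, k) = (if k = i then if bit i (m - 1) then 1 else 0 else 0)"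
      if "k < 2 ^ m" for k
    proof -
      have k: "k < 2 * 2 ^ s"
        using that by (simp add: s)
      have "bit i (m - 1) \<longleftrightarrow> i div 2 ^ s = 1"
        using div_mod_less_mult(1)[OF i] by (auto simp: bit_iff_odd s less_2_cases_iff)
      moreover have "k = i \<longleftrightarrow> k div 2 ^ s = i div 2 ^ s \<and> k mod 2 ^ s = i mod 2 ^ s"
        by (metis div_mult_mod_eq)
      ultimately show ?thesis
        using i k div_mod_less_mult[OF i] div_mod_less_mult[OF k] c
        by (auto simp: K_def P_def less_2_cases_iff simp flip: numeral_2_eq_2)
    qed
    have "((P \<otimes>\<^sub>k K) * U) $$ (i, j) = (\<Sum>k<2 ^ m. (P \<otimes>\<^sub>k K) $$ (i, k) * U $$ (k, j))"
      using that i c c' by (auto simp: scalar_prod_def lessThan_atLeast0 s)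
    also have "\<dots> = (\<Sum>k<2 ^ m. if k = i then if bit i (m - 1) then U $$ (i, j) else 0 else 0)"
      by (intro sum.cong) (auto simp: entry)
    finally show ?thesis
      using that by (simp add: sum.delta)
  qed
  have "complex_of_real (first_qubit_prob m (U *\<^sub>v ket bs) True) = (\<Sum>q<m. g q (bs ! q))"
    if bs: "length bs = m" for bs
  proof -
    have j: "ket_index bs < 2 ^ m"
      using ket_index_less[of bs] bs by simp
    have "(P \<otimes>\<^sub>k K) * U \<in> carrier_mat (2 ^ m) (2 ^ m)"
      unfolding PK by (rule mult_carrier_mat c')+
    then have "(mat_adjoint U * ((P \<otimes>\<^sub>k K) * U)) $$ (ket_index bs, ket_index bs)
      = (\<Sum>i<2 ^ m. cnj (U $$ (i, ket_index bs)) * ((P \<otimes>\<^sub>k K) * U) $$ (i, ket_index bs))"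
      using c'(1) j by (intro mat_adjoint_mult_index)
    also have "\<dots> = (\<Sum>i<2 ^ m. complex_of_real
        (if bit i (m - 1) then (cmod (U $$ (i, ket_index bs)))\<^sup>2 else 0))"
      using j by (intro sum.cong) (auto simp: Pi complex_norm_square mult.commute simp del: of_real_power)
    also have "\<dots> = complex_of_real (first_qubit_prob m (U *\<^sub>v ket bs) True)"
      unfolding first_qubit_prob_ket[OF c'(1) bs] by simp
    finally show ?thesis
      unfolding conj g[OF bs] by simp
  qed
  \<comment> \<open>The functions of single bits are complex so far. The sum is real, so their real
    parts give the same total.\<close>
  then have "first_qubit_prob m (U *\<^sub>v ket bs) True = (\<Sum>q<m. Re (g q (bs ! q)))"
    if "length bs = m" for bs
    using that by (metis Re_complex_of_real Re_sum)
  then show thesis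
    by (rule that)
qed

section \<open>Circuits for affine expectations\<close>

text \<open>The sign is opposite to the eigenvalue of Z. With it, the expected spin of an outcome is
  twice the probability of \<open>True\<close> minus 1.\<close>

definition spin :: "bool \<Rightarrow> real" where
  "spin b = (if b then 1 else -1)"

lemma spin_simps [simp]: "spin True = 1" "spin False = -1" "spin b * spin b = 1" "\<bar>spin b\<bar> = 1"
  by (auto simp: spin_def)

lemma special_unitary_rotation:
  fixes c s :: real
  assumes "c\<^sup>2 + s\<^sup>2 = 1"
  shows "mat_of_rows_list 2 [[complex_of_real c, - complex_of_real s], [complex_of_real s, complex_of_real c]]
    \<in> special_unitary 2"
proof -
  have "complex_of_real c * complex_of_real c + complex_of_real s * complex_of_real s = 1"
    using assms by (simp add: power2_eq_square flip: of_real_mult of_real_add)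
  then show ?thesis
    unfolding special_unitary_two_iff by (simp add: add.commute)
qed

section \<open>Extending a circuit by a qubit on the left\<close>

lemma on_neighbours_Suc:
  assumes "1 \<le> k"
  shows "on_neighbours (Suc m) (Suc k) G = 1\<^sub>m 2 \<otimes>\<^sub>k on_neighbours m k G"
proof -
  obtain r where k: "k = Suc r"
    using assms by (cases k) auto
  have "1\<^sub>m (2 ^ k) = 1\<^sub>m 2 \<otimes>\<^sub>k 1\<^sub>m (2 ^ r)"
    by (simp add: k kronecker_one_one)
  then show ?thesis
    by (simp add: on_neighbours_def k kronecker_assoc)
qed

lemma circuit_prepend_qubit:
  "U \<in> matchgate_circuits m \<Longrightarrow> 1\<^sub>m 2 \<otimes>\<^sub>k U \<in> matchgate_circuits (Suc m)"
proof (induction rule: matchgate_circuits.induct)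
  case empty
  then show ?case
    using matchgate_circuits.empty[of "Suc m"] by (simp add: kronecker_one_one)
next
  case (gate U G k)
  have "on_neighbours (Suc m) (Suc k) G * (1\<^sub>m 2 \<otimes>\<^sub>k U) = (1\<^sub>m 2 * 1\<^sub>m 2) \<otimes>\<^sub>k (on_neighbours m k G * U)"
    unfolding on_neighbours_Suc[OF gate.hyps(3)]
    by (rule kronecker_mult one_carrier_mat on_neighbours_carrier matchgate_carrier circuit_carrier gate.hyps)+
  then show ?case
    using matchgate_circuits.gate[OF gate.IH gate.hyps(2), of "Suc k"] gate.hyps by simp
qed

text \<open>\<open>G\<close> acts on the leading digit of a row index and does so separately for
  each value \<open>q\<close> of the remaining digits.\<close>

lemma kronecker_one_mult_index:
  assumes "G \<in> carrier_mat r s" "V \<in> carrier_mat (s * K) c" "i < r" "q < K" "j < c"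
  shows "((G \<otimes>\<^sub>k 1\<^sub>m K) * V) $$ (i * K + q, j) = (\<Sum>l<s. G $$ (i, l) * V $$ (l * K + q, j))"
proof -
  have less: "a * K + b < a' * K" if "a < a'" "b < K" for a b a' :: nat
  proof -
    have "a * K + b < Suc a * K"
      using that by simp
    also have "\<dots> \<le> a' * K"
      using that by (intro mult_right_mono) auto
    finally show ?thesis .
  qed
  have "((G \<otimes>\<^sub>k 1\<^sub>m K) * V) $$ (i * K + q, j)
      = (\<Sum>l<s * K. (G \<otimes>\<^sub>k 1\<^sub>m K) $$ (i * K + q, l) * V $$ (l, j))"
    using assms less by (simp add: scalar_prod_def lessThan_atLeast0 del: kronecker_index)
  also have "\<dots> = (\<Sum>l<s. \<Sum>p<K. if p = q then G $$ (i, l) * V $$ (l * K + q, j) else 0)"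
    unfolding sum_lessThan_mult using assms less by (intro sum.cong) auto
  finally show ?thesis
    using assms by (simp add: sum.delta)
qed

text \<open>A gate rotating the even block by an angle with squared sine \<open>A\<close> and the odd block by one
  with squared sine \<open>B\<close>, applied to a bit next to the first qubit of an arbitrary state, mixes the
  bit and the outcome of that qubit classically: \<open>w = 1 - A - B\<close> and \<open>s = B - A\<close>.\<close>

lemma circuit_mix_bit:
  fixes w s :: real
  assumes U: "U \<in> matchgate_circuits m" and m: "1 \<le> m" and ws: "\<bar>w\<bar> + \<bar>s\<bar> \<le> 1"
  obtains U' where "U' \<in> matchgate_circuits (Suc m)"
    "\<And>b bs. length bs = m \<Longrightarrow> 2 * first_qubit_prob (Suc m) (U' *\<^sub>v ket (b # bs)) True - 1
       = w * spin b + s * (2 * first_qubit_prob m (U *\<^sub>v ket bs) True - 1)"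
proof -
  obtain t where t: "m = Suc t"
    using m by (cases m) auto
  define K :: nat where "K = 2 ^ t"
  have K: "2 ^ m = 2 * K" "2 ^ Suc m = 4 * K" "0 < K"
    by (auto simp: K_def t)
  \<comment> \<open>These solve \<open>w = 1 - A - B\<close> and \<open>s = B - A\<close>. The bound
    on \<open>w\<close> and \<open>s\<close> is what puts both into the unit interval.\<close>
  define A where "A = (1 - w - s) / 2"
  define B where "B = (1 - w + s) / 2"
  have AB: "0 \<le> A" "A \<le> 1" "0 \<le> B" "B \<le> 1"
    using ws by (auto simp: A_def B_def)
  define a where "a = complex_of_real (sqrt (1 - A))"
  define c where "c = complex_of_real (sqrt A)"
  define y where "y = complex_of_real (sqrt (1 - B))"
  define x where "x = complex_of_real (sqrt B)"
  define G where "G = mat_of_rows_list 4 [[a, 0, 0, - c], [0, y, - x, 0], [0, x, y, 0], [c, 0, 0, a]]"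
  have "mat_of_rows_list 2 [[a, - c], [c, a]] \<in> special_unitary 2"
    "mat_of_rows_list 2 [[y, - x], [x, y]] \<in> special_unitary 2"
    unfolding a_def c_def x_def y_def using AB by (intro special_unitary_rotation; simp)+
  then have gate: "is_matchgate G"
    unfolding is_matchgate_def G_def by blast
  have G: "G \<in> carrier_mat 4 4"
    by (rule matchgate_carrier[OF gate])
  define V where "V = 1\<^sub>m 2 \<otimes>\<^sub>k U"
  define U' where "U' = on_neighbours (Suc m) 1 G * V"
  have U_carrier: "U \<in> carrier_mat (2 * K) (2 * K)"
    using circuit_carrier[OF U] by (simp add: K)
  have V: "V \<in> carrier_mat (4 * K) (4 * K)"
    using kronecker_carrier[OF one_carrier_mat U_carrier, of 2] by (simp add: V_def)
  have U'_circuit: "U' \<in> matchgate_circuits (Suc m)"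
    unfolding U'_def V_def
    by (rule matchgate_circuits.gate[OF circuit_prepend_qubit[OF U] gate]) (use m in auto)
  have U': "U' = (G \<otimes>\<^sub>k 1\<^sub>m K) * V"
    by (simp add: U'_def on_neighbours_def t K_def)
  have "2 * first_qubit_prob (Suc m) (U' *\<^sub>v ket (b # bs)) True - 1
       = w * spin b + s * (2 * first_qubit_prob m (U *\<^sub>v ket bs) True - 1)"
    if bs: "length bs = m" for b bs
  proof -
    define j where "j = ket_index bs"
    have j: "j < 2 * K"
      using ket_index_less[of bs] bs by (simp add: j_def K)
    have index: "ket_index (b # bs) = of_bool b * (2 * K) + j"
      using bs by (simp add: horner_sum_append j_def K(1))
    define j' where "j' = ket_index (b # bs)"
    have j': "j' < 4 * K" "j' div (2 * K) = of_bool b" "j' mod (2 * K) = j"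
      unfolding j'_def index using j by (cases b; simp)+
    \<comment> \<open>\<open>V\<close> is block diagonal: the column of input bit \<open>b\<close>
      is supported on the rows with leading bit \<open>b\<close>. Below, rows are written
      \<open>i * K + q\<close>, where \<open>i\<close> encodes the new bit and the former first
      qubit.\<close>
    have V_index: "V $$ (i, j') = (if i div (2 * K) = of_bool b then U $$ (i mod (2 * K), j) else 0)"
      if "i < 4 * K" for i
      using that j' U_carrier div_mod_less_mult(1)[of i 2 "2 * K"] by (auto simp: V_def)
    have V_low: "V $$ (q, j') = (if b then 0 else U $$ (q, j))"
      "V $$ (K + q, j') = (if b then 0 else U $$ (K + q, j))"
      "V $$ (2 * K + q, j') = (if b then U $$ (q, j) else 0)"
      "V $$ (3 * K + q, j') = (if b then U $$ (K + q, j) else 0)" if "q < K" for q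
    proof -
      have "3 * K + q = 2 * K + (K + q)"
        by simp
      then have "(3 * K + q) div (2 * K) = 1" "(3 * K + q) mod (2 * K) = K + q"
        using that by (simp_all only: div_add_self1 mod_add_self1) auto
      then show "V $$ (q, j') = (if b then 0 else U $$ (q, j))"
        "V $$ (K + q, j') = (if b then 0 else U $$ (K + q, j))"
        "V $$ (2 * K + q, j') = (if b then U $$ (q, j) else 0)"
        "V $$ (3 * K + q, j') = (if b then U $$ (K + q, j) else 0)"
        using that by (subst V_index; auto)+
    qed
    have rows: "U' $$ (i * K + q, j') = (\<Sum>l<4. G $$ (i, l) * V $$ (l * K + q, j'))"
      if "i < 4" "q < K" for i q
      unfolding U' by (rule kronecker_one_mult_index[OF G V that j'(1)])
    \<comment> \<open>Outcome 1 means the rows with leading digit 2 or 3. For fixed \<open>b\<close>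
      only one of the two amplitudes that the gate would superpose is nonzero, so there is no
      interference.\<close>
    have row2: "U' $$ (2 * K + q, j') = (if b then y * U $$ (q, j) else x * U $$ (K + q, j))"
      if "q < K" for q
      by (simp add: rows that lessThan_atLeast0 sum_upt_four V_low[OF that]) (simp add: G_def)
    have row3: "U' $$ (3 * K + q, j') = (if b then a * U $$ (K + q, j) else c * U $$ (q, j))"
      if "q < K" for q
      by (simp add: rows that lessThan_atLeast0 sum_upt_four V_low[OF that]) (simp add: G_def)
    \<comment> \<open>The outcome probabilities of the inner circuit \<open>U\<close>.\<close>
    define p0 where "p0 = (\<Sum>q<K. (cmod (U $$ (q, j)))\<^sup>2)"
    define p1 where "p1 = (\<Sum>q<K. (cmod (U $$ (K + q, j)))\<^sup>2)"
    have "first_qubit_prob m (U *\<^sub>v ket bs) True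
        = (\<Sum>i<2 * K. if bit i t then (cmod (U $$ (i, j)))\<^sup>2 else 0)"
      using first_qubit_prob_ket[OF circuit_carrier[OF U] bs, of True]
      unfolding j_def K(1) by (simp add: t)
    also have "\<dots> = p1"
      unfolding sum_lessThan_mult
      by (simp add: lessThan_atLeast0[of 2] sum_upt_two p1_def bit_iff_odd flip: K_def)
    finally have P: "first_qubit_prob m (U *\<^sub>v ket bs) True = p1" .
    have "1 = (\<Sum>i<2 * K. (cmod (U $$ (i, j)))\<^sup>2)"
      using circuit_column_norm[OF U, of j] j by (simp add: K)
    also have "\<dots> = p0 + p1"
      unfolding sum_lessThan_mult by (simp add: lessThan_atLeast0[of 2] sum_upt_two p0_def p1_def)
    finally have p01: "p0 = 1 - p1"
      by simp
    have "first_qubit_prob (Suc m) (U' *\<^sub>v ket (b # bs)) True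
        = (\<Sum>i<4 * K. if bit i m then (cmod (U' $$ (i, j')))\<^sup>2 else 0)"
      using first_qubit_prob_ket[OF circuit_carrier[OF U'_circuit], of "b # bs" True] bs
      unfolding j'_def K(2) by simp
    also have "\<dots> = (\<Sum>q<K. (cmod (U' $$ (2 * K + q, j')))\<^sup>2) + (\<Sum>q<K. (cmod (U' $$ (3 * K + q, j')))\<^sup>2)"
    proof -
      have bits: "\<not> bit q m" "\<not> bit (K + q) m" "bit (2 * K + q) m" "bit (3 * K + q) m" if "q < K" for q
      proof -
        have "(3 * K + q) div (2 * K) = 1"
          using that by (intro div_nat_eqI) auto
        then show "\<not> bit q m" "\<not> bit (K + q) m" "bit (2 * K + q) m" "bit (3 * K + q) m"
          unfolding bit_iff_odd K(1) using that by simp_all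
      qed
      show ?thesis
        unfolding sum_lessThan_mult
        by (simp add: lessThan_atLeast0[of 4] sum_upt_four bits)
    qed
    also have "\<dots> = (if b then (1 - B) * p0 + (1 - A) * p1 else B * p1 + A * p0)"
      using AB by (simp add: row2 row3 a_def c_def x_def y_def norm_mult power_mult_distrib p0_def p1_def sum_distrib_left)
    finally show ?thesis
      unfolding P p01 by (simp add: A_def B_def spin_def field_simps)
  qed
  then show thesis
    using that U'_circuit by blast
qed

text \<open>Bits are added at the front by \<open>circuit_mix_bit\<close>, starting from the
  ancilla. Multiplying by the total weight instead of dividing covers weight zero. A lone ancilla,
  on which no gate fits, has expectation -1 whatever the sign of \<open>e0\<close>;
  \<open>\<sigma>\<close> records the mismatch until the first mixing step absorbs it.\<close>

lemma circuit_affine: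
  fixes e :: "nat \<Rightarrow> real"
  shows "\<exists>U\<in>matchgate_circuits (Suc n). \<exists>\<sigma>. \<bar>\<sigma>\<bar> = 1 \<and> (0 < n \<longrightarrow> \<sigma> = 1) \<and>
    (\<forall>x. length x = n \<longrightarrow>
      \<sigma> * (\<bar>e0\<bar> + (\<Sum>q<n. \<bar>e q\<bar>)) * (2 * first_qubit_prob (Suc n) (U *\<^sub>v ket (x @ [False])) True - 1)
        = e0 + (\<Sum>q<n. e q * spin (x ! q)))"
proof (induction n arbitrary: e)
  case 0
  have "first_qubit_prob (Suc 0) (1\<^sub>m 2 *\<^sub>v ket [False]) True = 0"
    using first_qubit_prob_ket[of "1\<^sub>m 2" "Suc 0" "[False]" True]
    by (simp add: lessThan_atLeast0 sum_upt_two)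
  then show ?case
    using matchgate_circuits.empty[of "Suc 0"]
    \<comment> \<open>The ancilla contributes -1, so \<open>\<sigma>\<close> has to be minus the
      sign of \<open>e0\<close>.\<close>
    by (intro bexI[of _ "1\<^sub>m 2"] exI[of _ "if 0 \<le> e0 then -1 else 1"]) auto
next
  case (Suc n)
  define T where "T = \<bar>e0\<bar> + (\<Sum>q<n. \<bar>e (Suc q)\<bar>)"
  obtain U \<sigma> where U: "U \<in> matchgate_circuits (Suc n)" and \<sigma>: "\<bar>\<sigma>\<bar> = 1" and
    IH: "\<And>x. length x = n \<Longrightarrow> \<sigma> * T * (2 * first_qubit_prob (Suc n) (U *\<^sub>v ket (x @ [False])) True - 1)
        = e0 + (\<Sum>q<n. e (Suc q) * spin (x ! q))"
    using Suc.IH[of "\<lambda>q. e (Suc q)"] unfolding T_def by blast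
  have T: "0 \<le> T"
    by (auto simp: T_def intro!: add_nonneg_nonneg sum_nonneg)
  have total: "\<bar>e0\<bar> + (\<Sum>q<Suc n. \<bar>e q\<bar>) = \<bar>e 0\<bar> + T"
    unfolding T_def sum.lessThan_Suc_shift by simp
  \<comment> \<open>The weights are relative to the new total; \<open>e 0\<close> is the coefficient
    of the new first bit, unlike the constant \<open>e0\<close>. If the total is zero, both
    quotients are 0 and the equations below read 0 = 0.\<close>
  define w where "w = e 0 / (\<bar>e 0\<bar> + T)"
  define s where "s = \<sigma> * T / (\<bar>e 0\<bar> + T)"
  have "\<bar>w\<bar> + \<bar>s\<bar> \<le> 1"
    using T \<sigma> by (simp add: w_def s_def abs_mult flip: add_divide_distrib)
  then obtain U' where U': "U' \<in> matchgate_circuits (Suc (Suc n))" and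
    prob: "\<And>b bs. length bs = Suc n \<Longrightarrow> 2 * first_qubit_prob (Suc (Suc n)) (U' *\<^sub>v ket (b # bs)) True - 1
       = w * spin b + s * (2 * first_qubit_prob (Suc n) (U *\<^sub>v ket bs) True - 1)"
    using circuit_mix_bit[OF U, of w s] by auto
  have "(\<bar>e 0\<bar> + T) * (2 * first_qubit_prob (Suc (Suc n)) (U' *\<^sub>v ket (x @ [False])) True - 1)
        = e0 + (\<Sum>q<Suc n. e q * spin (x ! q))" if x: "length x = Suc n" for x
  proof -
    obtain b y where y: "x = b # y" "length y = n"
      using x by (cases x) auto
    have "(\<bar>e 0\<bar> + T) * w = e 0" "(\<bar>e 0\<bar> + T) * s = \<sigma> * T"
      using T by (auto simp: w_def s_def)
    then have "(\<bar>e 0\<bar> + T) * (2 * first_qubit_prob (Suc (Suc n)) (U' *\<^sub>v ket (x @ [False])) True - 1)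
        = e 0 * spin b + \<sigma> * T * (2 * first_qubit_prob (Suc n) (U *\<^sub>v ket (y @ [False])) True - 1)"
      using prob[of "y @ [False]" b] y by (simp add: distrib_left flip: mult.assoc)
    then show ?thesis
      unfolding IH[OF y(2)] sum.lessThan_Suc_shift by (simp add: y(1))
  qed
  then show ?case
    using U' unfolding total by (intro bexI[of _ U'] exI[of _ 1]) auto
qed

section \<open>Affine expectations of arbitrary circuits\<close>

lemma first_qubit_prob_spin:
  assumes "U \<in> matchgate_circuits m" "length bs = m"
  shows "first_qubit_prob m (U *\<^sub>v ket bs) b
    = (1 + spin b * (2 * first_qubit_prob m (U *\<^sub>v ket bs) True - 1)) / 2"
  using first_qubit_prob_False[OF assms] by (cases b) auto

text \<open>Every function of one bit is affine in its spin, and the ancillas, all set to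
  \<open>False\<close>, contribute only to the constant.\<close>

lemma first_qubit_prob_affine:
  assumes "U \<in> matchgate_circuits m" "1 \<le> m" "n \<le> m"
  obtains e0 :: real and e :: "nat \<Rightarrow> real" where
    "\<And>x. length x = n \<Longrightarrow>
      2 * first_qubit_prob m (U *\<^sub>v ket (x @ replicate (m - n) False)) True - 1
        = e0 + (\<Sum>q<n. e q * spin (x ! q))"
proof -
  obtain g :: "nat \<Rightarrow> bool \<Rightarrow> real" where
    g: "\<And>bs. length bs = m \<Longrightarrow> first_qubit_prob m (U *\<^sub>v ket bs) True = (\<Sum>q<m. g q (bs ! q))"
    using first_qubit_prob_sum_of_bits[OF assms(1,2)] by blast
  define e0 where "e0 = (\<Sum>q<n. g q True + g q False) + 2 * (\<Sum>q=n..<m. g q False) - 1"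
  have "2 * first_qubit_prob m (U *\<^sub>v ket (x @ replicate (m - n) False)) True - 1
        = e0 + (\<Sum>q<n. (g q True - g q False) * spin (x ! q))" if x: "length x = n" for x
  proof -
    let ?x = "x @ replicate (m - n) False"
    have "(\<Sum>q<m. g q (?x ! q)) = (\<Sum>q<n. g q (?x ! q)) + (\<Sum>q=n..<m. g q (?x ! q))"
      using assms(3) by (simp add: lessThan_atLeast0 sum.atLeastLessThan_concat)
    also have "(\<Sum>q=n..<m. g q (?x ! q)) = (\<Sum>q=n..<m. g q False)"
      using x by (intro sum.cong) (auto simp: nth_append)
    also have "(\<Sum>q<n. g q (?x ! q)) = (\<Sum>q<n. g q (x ! q))"
      using x by (intro sum.cong) (auto simp: nth_append)
    finally have "2 * (\<Sum>q<m. g q (?x ! q)) = (\<Sum>q<n. 2 * g q (x ! q)) + 2 * (\<Sum>q=n..<m. g q False)"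
      by (simp add: sum_distrib_left)
    also have "(\<Sum>q<n. 2 * g q (x ! q))
        = (\<Sum>q<n. g q True + g q False + (g q True - g q False) * spin (x ! q))"
      by (intro sum.cong) (auto simp: spin_def)
    finally show ?thesis
      using g[of ?x] x assms(3) by (simp add: e0_def sum.distrib)
  qed
  then show thesis
    by (rule that)
qed

text \<open>Some sign vector gives every term the sign of \<open>e0\<close>. There nothing cancels,
  and the absolute value of the affine function is the sum of the absolute coefficients.\<close>

lemma affine_coefficients_le_one:
  fixes e0 :: real and e :: "nat \<Rightarrow> real"
  assumes "\<And>x. length x = n \<Longrightarrow> \<bar>e0 + (\<Sum>q<n. e q * spin (x ! q))\<bar> \<le> 1"
  shows "\<bar>e0\<bar> + (\<Sum>q<n. \<bar>e q\<bar>) \<le> 1"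
proof -
  define x where "x = map (\<lambda>q. 0 \<le> e q \<longleftrightarrow> 0 \<le> e0) [0..<n]"
  have "(\<Sum>q<n. e q * spin (x ! q)) = (\<Sum>q<n. spin (0 \<le> e0) * \<bar>e q\<bar>)"
    by (intro sum.cong) (auto simp: x_def spin_def)
  moreover have "e0 = spin (0 \<le> e0) * \<bar>e0\<bar>"
    by (auto simp: spin_def)
  ultimately have "e0 + (\<Sum>q<n. e q * spin (x ! q)) = spin (0 \<le> e0) * (\<bar>e0\<bar> + (\<Sum>q<n. \<bar>e q\<bar>))"
    by (simp add: distrib_left flip: sum_distrib_left)
  then have "\<bar>spin (0 \<le> e0) * (\<bar>e0\<bar> + (\<Sum>q<n. \<bar>e q\<bar>))\<bar> \<le> 1"
    using assms[of x] by (simp add: x_def)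
  then show ?thesis
    by (simp add: abs_mult)
qed

section \<open>Weighted majority sampling\<close>

text \<open>The outer bracket contains the expected spin of the output. Addition modulo 2 becomes
  multiplication of spins up to a minus sign, which the constant output does not carry.\<close>

lemma pmf_wms:
  assumes P: "set_pmf P \<subseteq> {1..n + 1}"
  shows "pmf (wms n P c x) b
    = (1 + spin b * ((\<Sum>q<n. pmf P (Suc q) * - spin (c ! q) * spin (x ! q)) + pmf P (Suc n) * spin (c ! n))) / 2"
proof -
  let ?out = "wms_output n c x"
  let ?K = "{1..n + 1}"
  have total: "(\<Sum>k\<in>?K. pmf P k) = 1"
    using P by (intro sum_pmf_eq_1) auto
  have "pmf (wms n P c x) b = measure P (?out -` {b} \<inter> set_pmf P)"
    by (simp add: wms_def pmf_map measure_Int_set_pmf)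
  also have "\<dots> = measure P ({k \<in> ?K. ?out k = b} \<inter> set_pmf P)"
    using P by (intro arg_cong[where f = "measure P"]) auto
  also have "\<dots> = (\<Sum>k\<in>{k \<in> ?K. ?out k = b}. pmf P k)"
    by (simp add: measure_Int_set_pmf measure_measure_pmf_finite)
  also have "\<dots> = (\<Sum>k\<in>?K. if ?out k = b then pmf P k else 0)"
    by (rule sum.inter_filter) simp
  \<comment> \<open>The indicator of two bits being equal is half of 1 plus the product of their
    spins.\<close>
  also have "\<dots> = (\<Sum>k\<in>?K. (pmf P k + spin b * (pmf P k * spin (?out k))) / 2)"
    by (intro sum.cong) (auto simp: spin_def)
  also have "\<dots> = (1 + spin b * (\<Sum>k\<in>?K. pmf P k * spin (?out k))) / 2"
    unfolding sum_divide_distrib[symmetric] sum.distrib total sum_distrib_left[symmetric] ..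
  also have "?K = Suc ` {..<Suc n}"
    by (simp add: image_Suc_lessThan)
  also have "(\<Sum>k\<in>Suc ` {..<Suc n}. pmf P k * spin (?out k)) = (\<Sum>q<Suc n. pmf P (Suc q) * spin (?out (Suc q)))"
    by (simp add: sum.reindex del: sum.lessThan_Suc)
  also have "\<dots> = (\<Sum>q<n. pmf P (Suc q) * - spin (c ! q) * spin (x ! q)) + pmf P (Suc n) * spin (c ! n)"
    by (auto simp: wms_output_def spin_def intro!: sum.cong)
  finally show ?thesis .
qed

text \<open>A sampling scheme amounts to an affine function of spins: the absolute values of the
  coefficients are the probabilities, their signs encode \<open>c\<close>.\<close>

lemma wms_computable_iff:
  "wms_computable n f p \<longleftrightarrow>
    (\<exists>e0 e. \<bar>e0\<bar> + (\<Sum>q<n. \<bar>e q\<bar>) = 1 \<and>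
      (\<forall>x. length x = n \<longrightarrow> p \<le> (1 + spin (f x) * (e0 + (\<Sum>q<n. e q * spin (x ! q)))) / 2))"
  (is "_ \<longleftrightarrow> (\<exists>e0 e. ?R e0 e)")
proof
  assume "wms_computable n f p"
  then obtain P c where P: "set_pmf P \<subseteq> {1..n + 1}" "length c = n + 1" and
    p: "\<And>x. length x = n \<Longrightarrow> p \<le> pmf (wms n P c x) (f x)"
    unfolding wms_computable_def by blast
  have "(\<Sum>k\<in>Suc ` {..<Suc n}. pmf P k) = 1"
    using P(1) by (intro sum_pmf_eq_1) (auto simp: image_Suc_lessThan)
  then have total: "(\<Sum>q<n. pmf P (Suc q)) + pmf P (Suc n) = 1"
    by (simp add: sum.reindex del: sum.lessThan_Suc) simp
  define e where "e q = pmf P (Suc q) * - spin (c ! q)" for q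
  define e0 where "e0 = pmf P (Suc n) * spin (c ! n)"
  have "?R e0 e"
    using p total unfolding pmf_wms[OF P(1)] e_def e0_def by (auto simp: abs_mult add.commute)
  then show "\<exists>e0 e. ?R e0 e"
    by blast
next
  assume "\<exists>e0 e. ?R e0 e"
  then obtain e0 e where total: "\<bar>e0\<bar> + (\<Sum>q<n. \<bar>e q\<bar>) = 1" and
    p: "\<And>x. length x = n \<Longrightarrow> p \<le> (1 + spin (f x) * (e0 + (\<Sum>q<n. e q * spin (x ! q)))) / 2"
    by blast
  define \<pi> where "\<pi> k = (if k \<in> {1..n} then \<bar>e (k - 1)\<bar> else if k = Suc n then \<bar>e0\<bar> else 0)" for k
  have \<pi>_nonneg: "0 \<le> \<pi> k" for k
    by (simp add: \<pi>_def)
  have "(\<Sum>k\<in>Suc ` {..<Suc n}. \<pi> k) = 1"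
    using total by (simp add: sum.reindex \<pi>_def add.commute)
  moreover have "(\<integral>\<^sup>+ k. ennreal (\<pi> k) \<partial>count_space UNIV) = (\<Sum>k\<in>Suc ` {..<Suc n}. ennreal (\<pi> k))"
    by (rule nn_integral_count_space') (auto simp: \<pi>_def image_Suc_lessThan)
  ultimately have "(\<integral>\<^sup>+ k. ennreal (\<pi> k) \<partial>count_space UNIV) = 1"
    by (simp only: sum_ennreal[OF \<pi>_nonneg] ennreal_1)
  then have pmf_P: "pmf (embed_pmf \<pi>) k = \<pi> k" for k
    by (intro pmf_embed_pmf \<pi>_nonneg)
  define P where "P = embed_pmf \<pi>"
  have P: "set_pmf P \<subseteq> {1..n + 1}"
    by (auto simp: P_def set_pmf_iff pmf_P \<pi>_def split: if_splits)
  \<comment> \<open>A negative coefficient means flipping the input bit. The last entry is the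
    constant output itself, hence the opposite comparison.\<close>
  define c where "c = map (\<lambda>q. e q < 0) [0..<n] @ [0 \<le> e0]"
  have "pmf P (Suc q) * - spin (c ! q) = e q" if "q < n" for q
    using that by (simp add: P_def pmf_P \<pi>_def c_def nth_append spin_def)
  moreover have "pmf P (Suc n) * spin (c ! n) = e0"
    by (simp add: P_def pmf_P \<pi>_def c_def nth_append spin_def)
  ultimately have "p \<le> pmf (wms n P c x) (f x)" if "length x = n" for x
    unfolding pmf_wms[OF P] using p[OF that] by (simp add: add.commute)
  then show "wms_computable n f p"
    unfolding wms_computable_def using P by (intro exI[of _ P] exI[of _ c]) (auto simp: c_def)
qed

theorem mainTheorem4:
  fixes n :: nat and p :: real and f :: "bool list \<Rightarrow> bool"
  assumes "n \<ge> 1" and "p \<in> {1/2<..1}"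
  shows "matchgate_computable n f p \<longleftrightarrow> wms_computable n f p"
proof
  assume "matchgate_computable n f p"
  then obtain m U where m: "n \<le> m" and U: "U \<in> matchgate_circuits m" and computes: "computes n m U f p"
    unfolding matchgate_computable_def by blast
  let ?P = "\<lambda>x. first_qubit_prob m (U *\<^sub>v ket (x @ replicate (m - n) False))"
  obtain e0 e where affine: "\<And>x. length x = n \<Longrightarrow> 2 * ?P x True - 1 = e0 + (\<Sum>q<n. e q * spin (x ! q))"
    using first_qubit_prob_affine[OF U _ m] assms(1) m by (metis order_trans)
  define E where "E x = e0 + (\<Sum>q<n. e q * spin (x ! q))" for x
  define W where "W = \<bar>e0\<bar> + (\<Sum>q<n. \<bar>e q\<bar>)"
  have prob: "?P x b = (1 + spin b * E x) / 2" if "length x = n" for x b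
    unfolding E_def affine[OF that, symmetric] using that m
    by (intro first_qubit_prob_spin[OF U]) simp
  have "\<bar>E x\<bar> \<le> 1" if "length x = n" for x
  proof -
    have "0 \<le> (1 + spin b * E x) / 2" for b
      unfolding prob[OF that, symmetric] by (rule first_qubit_prob_nonneg)
    from this[of True] this[of False] show ?thesis
      by simp
  qed
  then have W_le: "W \<le> 1"
    unfolding E_def W_def by (rule affine_coefficients_le_one)
  have p: "p \<le> (1 + spin (f x) * E x) / 2" if "length x = n" for x
    using computes that prob[OF that] unfolding computes_def by metis
  \<comment> \<open>Here \<open>p\<close> exceeding 1/2 enters: the expectation has strictly the
    sign of \<open>f x\<close>.\<close>
  then have pos: "0 < spin (f x) * E x" if "length x = n" for x
    using p[OF that] assms(2) by auto
  \<comment> \<open>With zero weight the expectation would vanish at every input, contradicting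
    strict positivity.\<close>
  have W: "0 < W"
  proof (rule ccontr)
    assume "\<not> 0 < W"
    moreover have "0 \<le> (\<Sum>q<n. \<bar>e q\<bar>)"
      by (rule sum_nonneg) simp
    ultimately have "e0 = 0" "(\<Sum>q<n. \<bar>e q\<bar>) = 0"
      unfolding W_def by linarith+
    then have "E (replicate n False) = 0"
      unfolding E_def by (simp add: sum_nonneg_eq_0_iff)
    then show False
      using pos[of "replicate n False"] by simp
  qed
  have "p \<le> (1 + spin (f x) * (e0 / W + (\<Sum>q<n. e q / W * spin (x ! q)))) / 2" if x: "length x = n" for x
  proof -
    have "e0 / W + (\<Sum>q<n. e q / W * spin (x ! q)) = E x / W"
      by (simp add: E_def add_divide_distrib sum_divide_distrib)
    \<comment> \<open>Dividing a positive quantity by \<open>W\<close>, which is at most 1, does not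
      decrease it.\<close>
    moreover have "spin (f x) * E x \<le> spin (f x) * E x / W"
      using pos[OF x] W W_le by (simp add: le_divide_eq mult_left_le)
    ultimately show ?thesis
      using p[OF x] by (simp add: field_simps)
  qed
  moreover have "\<bar>e0 / W\<bar> + (\<Sum>q<n. \<bar>e q / W\<bar>) = 1"
  proof -
    have "\<bar>e0 / W\<bar> + (\<Sum>q<n. \<bar>e q / W\<bar>) = W / W"
      using W by (subst (3) W_def) (simp add: add_divide_distrib sum_divide_distrib)
    then show ?thesis
      using W by simp
  qed
  ultimately show "wms_computable n f p"
    unfolding wms_computable_iff by (intro exI[of _ "e0 / W"] exI[of _ "\<lambda>q. e q / W"]) simp
next
  assume "wms_computable n f p"
  then obtain e0 e where total: "\<bar>e0\<bar> + (\<Sum>q<n. \<bar>e q\<bar>) = 1" and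
    p: "\<And>x. length x = n \<Longrightarrow> p \<le> (1 + spin (f x) * (e0 + (\<Sum>q<n. e q * spin (x ! q)))) / 2"
    unfolding wms_computable_iff by blast
  \<comment> \<open>As \<open>n\<close> is positive, \<open>\<sigma>\<close> is 1, and the total
    weight is 1, so the circuit has exactly the expectation of the sampling scheme. One ancilla
    suffices.\<close>
  obtain U where U: "U \<in> matchgate_circuits (Suc n)" and
    prob: "\<And>x. length x = n \<Longrightarrow> 2 * first_qubit_prob (Suc n) (U *\<^sub>v ket (x @ [False])) True - 1
        = e0 + (\<Sum>q<n. e q * spin (x ! q))"
    using circuit_affine[of n e0 e] assms(1) unfolding total by auto
  have "p \<le> first_qubit_prob (Suc n) (U *\<^sub>v ket (x @ [False])) (f x)" if x: "length x = n" for x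
    using p[OF x] first_qubit_prob_spin[OF U, of "x @ [False]" "f x"] x unfolding prob[OF x] by simp
  then have "computes n (Suc n) U f p"
    by (simp add: computes_def)
  then show "matchgate_computable n f p"
    unfolding matchgate_computable_def using U le_SucI by blast
qed

end
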